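(* Suppose that $X$ and $Y$ are uniformly locally finite metric spaces and $Y$ coarsely embeds into a Hilbert space. If $\mathrm{C}^*_u(X)$ and $\mathrm{C}^*_u(Y)$ are isomorphic, then $X$ and $Y$ are coarsely equivalent.
   Context: A metric space $(X,d)$ is uniformly locally finite if $\sup_{x\in X}|B_r(x)|<\infty$ for all $r>0$. An operator $a\in\mathcal{B}(\ell_2(X))$ has finite propagation if there is $r>0$ with $\langle a\delta_x,\delta_y\rangle=0$ whenever $d(x,y)>r$, where $(\delta_x)_{x\in X}$ is the canonical basis. The uniform Roe algebra $\mathrm{C}^*_u(X)$ is the norm closure in $\mathcal{B}(\ell_2(X))$ of the finite propagation operators. Isomorphic means $^*$-isomorphic as $\mathrm{C}^*$-algebras. A map $f\colon(X,d)\to(Y,\partial)$ is coarse if $\sup\{\partial(f(x),f(y))\mid d(x,y)\leq r\}<\infty$ for all $r>0$, expanding if $\lim_{r\to\infty}\inf\{\partial(f(x),f(y))\mid d(x,y)\geq r\}=\infty$, and a coarse embedding if it is both. $X$ and $Y$ are coarsely equivalent if there are coarse maps $f\colon X\to Y$ and $g\colon Y\to X$ with $\sup_{x}d(g(f(x)),x)<\infty$ and $\sup_y\partial(f(g(y)),y)<\infty$. *)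

theory Defs
  imports "HOL-Analysis.Analysis"
begin

section \<open>Coarse geometry\<close>

definition uniformly_locally_finite :: "'a::metric_space itself \<Rightarrow> bool" where
  "uniformly_locally_finite _ \<longleftrightarrow>
     (\<forall>r>0. \<exists>N. \<forall>x::'a. finite (cball x r) \<and> card (cball x r) \<le> N)"

text \<open>The suprema and infima below are taken in the extended reals, so that the infimum of the
  empty set is infinite and every map on a bounded space is expanding.\<close>

definition coarse_map :: "('a::metric_space \<Rightarrow> 'b::metric_space) \<Rightarrow> bool" where
  "coarse_map f \<longleftrightarrow>
     (\<forall>r>0. (SUP (x, y)\<in>{(x, y). dist x y \<le> r}. ereal (dist (f x) (f y))) < \<infinity>)"

definition expanding_map :: "('a::metric_space \<Rightarrow> 'b::metric_space) \<Rightarrow> bool" where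
  "expanding_map f \<longleftrightarrow>
     ((\<lambda>r::real. INF (x, y)\<in>{(x, y). dist x y \<ge> r}. ereal (dist (f x) (f y))) \<longlongrightarrow> \<infinity>) at_top"

definition coarse_embedding :: "('a::metric_space \<Rightarrow> 'b::metric_space) \<Rightarrow> bool" where
  "coarse_embedding f \<longleftrightarrow> coarse_map f \<and> expanding_map f"

definition coarsely_equivalent :: "'a::metric_space itself \<Rightarrow> 'b::metric_space itself \<Rightarrow> bool" where
  "coarsely_equivalent _ _ \<longleftrightarrow>
     (\<exists>(f :: 'a \<Rightarrow> 'b) (g :: 'b \<Rightarrow> 'a). coarse_map f \<and> coarse_map g \<and>
        (SUP x. ereal (dist (g (f x)) x)) < \<infinity> \<and> (SUP y. ereal (dist (f (g y)) y)) < \<infinity>)"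


section \<open>The complex Hilbert space of square-summable functions\<close>

typedef 'a ell2 = "{f :: 'a \<Rightarrow> complex. (\<lambda>x. (cmod (f x))\<^sup>2) summable_on UNIV}"
  morphisms ell2_fun Abs_ell2
  by (rule exI[of _ "\<lambda>_. 0"]) simp

setup_lifting type_definition_ell2

lemma ell2_mult_abs_summable:
  fixes f g :: "'a \<Rightarrow> complex"
  assumes "(\<lambda>x. (cmod (f x))\<^sup>2) summable_on UNIV" "(\<lambda>x. (cmod (g x))\<^sup>2) summable_on UNIV"
  shows "(\<lambda>x. cmod (f x * g x)) summable_on UNIV"
proof (rule summable_on_comparison_test)
  show "(\<lambda>x. (cmod (f x))\<^sup>2 + (cmod (g x))\<^sup>2) summable_on UNIV"
    using assms by (rule summable_on_add)
  show "cmod (f x * g x) \<le> (cmod (f x))\<^sup>2 + (cmod (g x))\<^sup>2" for x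
  proof -
    have "0 \<le> (cmod (f x) - cmod (g x))\<^sup>2" by simp
    then have "2 * (cmod (f x) * cmod (g x)) \<le> (cmod (f x))\<^sup>2 + (cmod (g x))\<^sup>2"
      by (simp add: power2_diff)
    moreover have "0 \<le> cmod (f x) * cmod (g x)" by simp
    ultimately show ?thesis unfolding norm_mult by linarith
  qed
qed auto

lemma ell2_add_closed:
  fixes f g :: "'a \<Rightarrow> complex"
  assumes "(\<lambda>x. (cmod (f x))\<^sup>2) summable_on UNIV" "(\<lambda>x. (cmod (g x))\<^sup>2) summable_on UNIV"
  shows "(\<lambda>x. (cmod (f x + g x))\<^sup>2) summable_on UNIV"
proof (rule summable_on_comparison_test)
  show "(\<lambda>x. 2 * ((cmod (f x))\<^sup>2 + (cmod (g x))\<^sup>2)) summable_on UNIV"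
    using assms by (intro summable_on_cmult_right summable_on_add)
  show "(cmod (f x + g x))\<^sup>2 \<le> 2 * ((cmod (f x))\<^sup>2 + (cmod (g x))\<^sup>2)" for x
  proof -
    have "(cmod (f x + g x))\<^sup>2 \<le> (cmod (f x) + cmod (g x))\<^sup>2"
      by (rule power_mono[OF norm_triangle_ineq]) simp
    moreover have "0 \<le> (cmod (f x) - cmod (g x))\<^sup>2" by simp
    ultimately show ?thesis by (simp add: power2_diff power2_sum)
  qed
qed auto

lemma ell2_scale_closed:
  fixes f :: "'a \<Rightarrow> complex"
  assumes "(\<lambda>x. (cmod (f x))\<^sup>2) summable_on UNIV"
  shows "(\<lambda>x. (cmod (c * f x))\<^sup>2) summable_on UNIV"
  unfolding norm_mult power_mult_distrib using assms by (rule summable_on_cmult_right)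

lift_definition ell2_scale :: "complex \<Rightarrow> 'a ell2 \<Rightarrow> 'a ell2" is "\<lambda>c f x. c * f x"
  by (simp add: ell2_scale_closed)

lift_definition ell2_inner :: "'a ell2 \<Rightarrow> 'a ell2 \<Rightarrow> complex"
  is "\<lambda>f g. \<Sum>\<^sub>\<infinity>x. f x * cnj (g x)" .

lemma ell2_diff_closed:
  fixes f g :: "'a \<Rightarrow> complex"
  assumes "(\<lambda>x. (cmod (f x))\<^sup>2) summable_on UNIV" "(\<lambda>x. (cmod (g x))\<^sup>2) summable_on UNIV"
  shows "(\<lambda>x. (cmod (f x - g x))\<^sup>2) summable_on UNIV"
  using ell2_add_closed[of f "\<lambda>x. - g x"] assms by simp

lemma ell2_basis_closed:
  "(\<lambda>y. (cmod (if y = x then 1 else 0))\<^sup>2) summable_on UNIV"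
proof -
  have "(\<lambda>y. (cmod (if y = x then 1 else 0))\<^sup>2) summable_on {x}"
    by (rule summable_on_finite) simp
  then show ?thesis
    by (subst summable_on_cong_neutral[where T="{x}"]) auto
qed

lift_definition ell2_basis :: "'a \<Rightarrow> 'a ell2" is "\<lambda>x y. if y = x then 1 else 0"
  by (simp only: mem_Collect_eq ell2_basis_closed)

instantiation ell2 :: (type) real_vector
begin

lift_definition zero_ell2 :: "'a ell2" is "\<lambda>_. 0" by simp
lift_definition plus_ell2 :: "'a ell2 \<Rightarrow> 'a ell2 \<Rightarrow> 'a ell2" is "\<lambda>f g x. f x + g x"
  by (simp add: ell2_add_closed)
lift_definition uminus_ell2 :: "'a ell2 \<Rightarrow> 'a ell2" is "\<lambda>f x. - f x" by simp
lift_definition minus_ell2 :: "'a ell2 \<Rightarrow> 'a ell2 \<Rightarrow> 'a ell2" is "\<lambda>f g x. f x - g x"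
  by (simp only: mem_Collect_eq ell2_diff_closed)
lift_definition scaleR_ell2 :: "real \<Rightarrow> 'a ell2 \<Rightarrow> 'a ell2" is "\<lambda>r f x. complex_of_real r * f x"
  by (simp only: mem_Collect_eq ell2_scale_closed)

instance
  by standard (transfer; simp add: algebra_simps)+

end

lemma ell2_summable: "(\<lambda>x. ell2_fun f x * cnj (ell2_fun g x)) summable_on UNIV"
proof -
  have "(\<lambda>x. cmod (ell2_fun f x * cnj (ell2_fun g x))) summable_on UNIV"
    by (rule ell2_mult_abs_summable) (use ell2_fun in auto)
  then show ?thesis by (rule abs_summable_summable)
qed

lemma ell2_inner_add_left: "ell2_inner (f + g) h = ell2_inner f h + ell2_inner g h"
  by (simp add: ell2_inner.rep_eq plus_ell2.rep_eq distrib_right infsum_add ell2_summable)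

lemma ell2_inner_scale_left: "ell2_inner (ell2_scale c f) h = c * ell2_inner f h"
  by (simp add: ell2_inner.rep_eq ell2_scale.rep_eq mult.assoc infsum_cmult_right')

lemma ell2_inner_cnj: "cnj (ell2_inner f g) = ell2_inner g f"
  by (simp add: ell2_inner.rep_eq mult.commute flip: infsum_cnj)

lemma scaleR_ell2_eq: "r *\<^sub>R f = ell2_scale (complex_of_real r) f"
  by transfer simp

lemma ell2_inner_self: "ell2_inner f f = complex_of_real (\<Sum>\<^sub>\<infinity>x. (cmod (ell2_fun f x))\<^sup>2)"
proof -
  have "ell2_inner f f = (\<Sum>\<^sub>\<infinity>x. complex_of_real ((cmod (ell2_fun f x))\<^sup>2))"
    by (simp only: ell2_inner.rep_eq complex_norm_square)
  also have "\<dots> = complex_of_real (\<Sum>\<^sub>\<infinity>x. (cmod (ell2_fun f x))\<^sup>2)"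
    by (rule infsumI[OF has_sum_bounded_linear[OF bounded_linear_of_real has_sum_infsum]])
       (use ell2_fun[of f] in simp)
  finally show ?thesis .
qed

instantiation ell2 :: (type) real_inner
begin

definition inner_ell2 :: "'a ell2 \<Rightarrow> 'a ell2 \<Rightarrow> real" where
  "inner_ell2 f g = Re (ell2_inner f g)"
definition norm_ell2 :: "'a ell2 \<Rightarrow> real" where
  "norm_ell2 f = sqrt (\<Sum>\<^sub>\<infinity>x. (cmod (ell2_fun f x))\<^sup>2)"
definition dist_ell2 :: "'a ell2 \<Rightarrow> 'a ell2 \<Rightarrow> real" where
  "dist_ell2 f g = norm (f - g)"
definition sgn_ell2 :: "'a ell2 \<Rightarrow> 'a ell2" where
  "sgn_ell2 f = f /\<^sub>R norm f"
definition uniformity_ell2 :: "('a ell2 \<times> 'a ell2) filter" where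
  "uniformity_ell2 = (INF e\<in>{0<..}. principal {(x, y). dist x y < e})"
definition open_ell2 :: "'a ell2 set \<Rightarrow> bool" where
  "open_ell2 U \<longleftrightarrow> (\<forall>x\<in>U. eventually (\<lambda>(x', y). x' = x \<longrightarrow> y \<in> U) uniformity)"

instance
proof
  fix x y z :: "'a ell2" and r :: real and U :: "'a ell2 set"
  show "dist x y = norm (x - y)" by (rule dist_ell2_def)
  show "sgn x = x /\<^sub>R norm x" by (rule sgn_ell2_def)
  show "uniformity = (INF e\<in>{0<..}. principal {(x, y :: 'a ell2). dist x y < e})"
    by (rule uniformity_ell2_def)
  show "open U \<longleftrightarrow> (\<forall>x\<in>U. eventually (\<lambda>(x', y). x' = x \<longrightarrow> y \<in> U) uniformity)"
    by (rule open_ell2_def)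
  show "inner x y = inner y x"
    unfolding inner_ell2_def by (subst ell2_inner_cnj[symmetric]) simp
  show "inner (x + y) z = inner x z + inner y z"
    by (simp add: inner_ell2_def ell2_inner_add_left)
  show "inner (r *\<^sub>R x) y = r * inner x y"
    by (simp add: inner_ell2_def scaleR_ell2_eq ell2_inner_scale_left)
  show "0 \<le> inner x x"
    by (simp add: inner_ell2_def ell2_inner_self infsum_nonneg)
  show "norm x = sqrt (inner x x)"
    by (simp add: inner_ell2_def ell2_inner_self norm_ell2_def)
  show "inner x x = 0 \<longleftrightarrow> x = 0"
  proof
    assume "inner x x = 0"
    then have *: "(\<Sum>\<^sub>\<infinity>a. (cmod (ell2_fun x a))\<^sup>2) \<le> 0"
      by (simp add: inner_ell2_def ell2_inner_self)
    have "(cmod (ell2_fun x a))\<^sup>2 = 0" for a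
      by (rule nonneg_infsum_le_0D[OF *]) (use ell2_fun[of x] in auto)
    then show "x = 0" by transfer auto
  qed (simp add: inner_ell2_def ell2_inner_self zero_ell2.rep_eq)
qed

end


section \<open>Operators on the Hilbert space\<close>

text \<open>Elements of the type \<open>'a ell2 \<Rightarrow>\<^sub>L 'a ell2\<close> are bounded and real-linear; the algebra
  of bounded operators on the complex Hilbert space consists of the complex-linear ones.\<close>

definition ell2_operators :: "('a ell2 \<Rightarrow>\<^sub>L 'a ell2) set" where
  "ell2_operators = {a. \<forall>c f. blinfun_apply a (ell2_scale c f) = ell2_scale c (blinfun_apply a f)}"

lemma norm_ell2_scale: "norm (ell2_scale c f) = cmod c * norm f"
  by (simp add: norm_ell2_def ell2_scale.rep_eq norm_mult power_mult_distrib
      infsum_cmult_right' real_sqrt_mult)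

lemma bounded_linear_ell2_scale: "bounded_linear (ell2_scale c)"
proof (rule bounded_linear_intro)
  show "ell2_scale c (f + g) = ell2_scale c f + ell2_scale c g" for f g
    by transfer (simp add: distrib_left)
  show "ell2_scale c (r *\<^sub>R f) = r *\<^sub>R ell2_scale c f" for r f
    by transfer (simp add: mult_ac)
  show "norm (ell2_scale c f) \<le> norm f * cmod c" for f
    by (simp add: norm_ell2_scale)
qed

definition op_scale :: "complex \<Rightarrow> ('a ell2 \<Rightarrow>\<^sub>L 'a ell2) \<Rightarrow> ('a ell2 \<Rightarrow>\<^sub>L 'a ell2)" where
  "op_scale c a = Blinfun (\<lambda>f. ell2_scale c (blinfun_apply a f))"

lemma op_scale_apply: "blinfun_apply (op_scale c a) f = ell2_scale c (blinfun_apply a f)"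
  unfolding op_scale_def
  by (simp add: bounded_linear_Blinfun_apply
      bounded_linear_compose[OF bounded_linear_ell2_scale blinfun.bounded_linear_right])

definition adjoint_op :: "('a ell2 \<Rightarrow>\<^sub>L 'a ell2) \<Rightarrow> ('a ell2 \<Rightarrow>\<^sub>L 'a ell2)" where
  "adjoint_op a = (THE b. \<forall>f g. ell2_inner (blinfun_apply a f) g = ell2_inner f (blinfun_apply b g))"

text \<open>The description above is meaningful: every bounded operator has a unique adjoint.\<close>

lemma norm_ell2_square: "(norm f)\<^sup>2 = (\<Sum>\<^sub>\<infinity>x. (cmod (ell2_fun f x))\<^sup>2)"
  by (simp add: norm_ell2_def infsum_nonneg)

lemma ell2_fun_sum: "ell2_fun (\<Sum>x\<in>F. u x) y = (\<Sum>x\<in>F. ell2_fun (u x) y)"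
  by (induction F rule: infinite_finite_induct) (simp_all add: zero_ell2.rep_eq plus_ell2.rep_eq)

lemma ell2_fun_sum_basis:
  assumes "finite F"
  shows "ell2_fun (\<Sum>x\<in>F. ell2_scale (c x) (ell2_basis x)) y = (if y \<in> F then c y else 0)"
proof -
  have "(\<Sum>x\<in>F. c x * (if y = x then 1 else 0)) = (\<Sum>x\<in>F. if y = x then c y else 0)"
    by (rule sum.cong) auto
  then show ?thesis
    using assms by (simp add: ell2_fun_sum ell2_scale.rep_eq ell2_basis.rep_eq)
qed

lemma ell2_basis_has_sum: "((\<lambda>x. ell2_scale (ell2_fun f x) (ell2_basis x)) has_sum f) UNIV"
proof -
  let ?s = "\<lambda>F. \<Sum>x\<in>F. ell2_scale (ell2_fun f x) (ell2_basis x)"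
  let ?q = "\<lambda>x. (cmod (ell2_fun f x))\<^sup>2"
  have summ: "?q summable_on UNIV" using ell2_fun[of f] by simp
  have eq: "norm (?s F - f) = sqrt (infsum ?q UNIV - sum ?q F)" if "finite F" for F
  proof -
    have "(norm (?s F - f))\<^sup>2 = (\<Sum>\<^sub>\<infinity>x. if x \<in> F then 0 else ?q x)"
      unfolding norm_ell2_square
      by (rule infsum_cong) (simp add: minus_ell2.rep_eq ell2_fun_sum_basis[OF that])
    also have "\<dots> = infsum ?q (UNIV - F)"
      by (rule infsum_cong_neutral) auto
    also have "\<dots> = infsum ?q UNIV - infsum ?q F"
      by (rule infsum_Diff) (use summ that in auto)
    also have "infsum ?q F = sum ?q F" using that by (rule infsum_finite)
    finally show ?thesis
      by (rule real_sqrt_unique[OF _ norm_ge_zero, symmetric])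
  qed
  have "((\<lambda>F. sqrt (infsum ?q UNIV - sum ?q F)) \<longlongrightarrow> sqrt (infsum ?q UNIV - infsum ?q UNIV))
      (finite_subsets_at_top UNIV)"
    by (intro tendsto_intros infsum_tendsto summ)
  then have "((\<lambda>F. norm (?s F - f)) \<longlongrightarrow> 0) (finite_subsets_at_top UNIV)"
    unfolding diff_self real_sqrt_zero
    by (rule Lim_transform_eventually)
       (rule eventually_finite_subsets_at_top_weakI, rule eq[symmetric])
  then show ?thesis
    unfolding has_sum_def by (rule LIM_zero_cancel[OF tendsto_norm_zero_cancel])
qed

lemma ell2_inner_eq_inner: "ell2_inner f g = Complex (inner f g) (- inner (ell2_scale \<i> f) g)"
  by (simp add: complex_eq_iff inner_ell2_def ell2_inner_scale_left)

lemma ell2_inner_right_unique: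
  assumes "\<And>f. ell2_inner f g = ell2_inner f h"
  shows "g = h"
proof -
  have "inner f g = inner f h" for f using assms[of f] by (simp add: inner_ell2_def)
  then have "inner (g - h) (g - h) = 0" by (simp add: inner_diff_right)
  then show ?thesis by simp
qed

lemma ell2_inner_basis_left: "ell2_inner (ell2_scale c (ell2_basis x)) g = c * cnj (ell2_fun g x)"
proof -
  have "(\<Sum>\<^sub>\<infinity>y. (if y = x then 1 else 0) * cnj (ell2_fun g y)) = (\<Sum>\<^sub>\<infinity>y\<in>{x}. cnj (ell2_fun g y))"
    by (rule infsum_cong_neutral) auto
  then show ?thesis
    unfolding ell2_inner_scale_left by (simp add: ell2_inner.rep_eq ell2_basis.rep_eq)
qed

lemma ell2_inner_sum_left: "ell2_inner (sum u F) g = (\<Sum>x\<in>F. ell2_inner (u x) g)"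
proof (induction F rule: infinite_finite_induct)
  case (insert x F) then show ?case by (simp add: ell2_inner_add_left)
qed (simp_all add: ell2_inner.rep_eq zero_ell2.rep_eq)

lemma ell2_operator_adjoint_vector:
  assumes a: "a \<in> ell2_operators"
  obtains h where "\<And>f. ell2_inner (blinfun_apply a f) g = ell2_inner f h"
    and "norm h \<le> norm a * norm g"
proof -
  define k where "k x = ell2_inner g (blinfun_apply a (ell2_basis x))" for x
  let ?B = "norm a * norm g"
  have lin: "blinfun_apply a (ell2_scale c f) = ell2_scale c (blinfun_apply a f)" for c f
    using a by (simp add: ell2_operators_def)
  have bd: "(\<Sum>x\<in>F. (cmod (k x))\<^sup>2) \<le> ?B\<^sup>2" if F: "finite F" for F
  proof -
    define S where "S = (\<Sum>x\<in>F. (cmod (k x))\<^sup>2)"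
    define u where "u = (\<Sum>x\<in>F. ell2_scale (k x) (ell2_basis x))"
    have S0: "0 \<le> S" unfolding S_def by (rule sum_nonneg) simp
    have "(norm u)\<^sup>2 = (\<Sum>\<^sub>\<infinity>x. if x \<in> F then (cmod (k x))\<^sup>2 else 0)"
      unfolding norm_ell2_square u_def
      by (rule infsum_cong) (simp add: ell2_fun_sum_basis[OF F])
    also have "\<dots> = (\<Sum>\<^sub>\<infinity>x\<in>F. (cmod (k x))\<^sup>2)"
      by (rule infsum_cong_neutral) auto
    finally have nu: "(norm u)\<^sup>2 = S" using F by (simp add: S_def)
    have "ell2_inner (blinfun_apply a u) g = (\<Sum>x\<in>F. k x * cnj (k x))"
      unfolding u_def blinfun.sum_right lin
      by (simp add: ell2_inner_sum_left ell2_inner_scale_left k_def ell2_inner_cnj)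
    also have "\<dots> = complex_of_real S"
      by (simp add: S_def complex_norm_square del: of_real_power)
    finally have "inner (blinfun_apply a u) g = S" by (simp add: inner_ell2_def)
    then have "S \<le> norm (blinfun_apply a u) * norm g"
      by (metis norm_cauchy_schwarz)
    also have "\<dots> \<le> (norm a * norm u) * norm g"
      by (intro mult_right_mono norm_blinfun) simp
    finally have le: "norm u * norm u \<le> ?B * norm u"
      using nu by (simp add: power2_eq_square mult_ac)
    have "norm u \<le> ?B"
    proof (cases "norm u = 0")
      case False then show ?thesis using le by (metis mult_le_cancel_right_pos norm_ge_zero order_le_less)
    qed (metis mult_nonneg_nonneg norm_ge_zero)
    then show ?thesis using nu by (metis S_def norm_ge_zero power_mono)
  qed
  have summ: "(\<lambda>x. (cmod (k x))\<^sup>2) summable_on UNIV"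
    by (rule nonneg_bounded_partial_sums_imp_summable_on[where C="?B\<^sup>2"])
       (auto intro!: eventually_finite_subsets_at_top_weakI bd)
  define h where "h = Abs_ell2 k"
  have hk: "ell2_fun h = k" unfolding h_def by (rule Abs_ell2_inverse) (simp add: summ)
  have "(norm h)\<^sup>2 \<le> ?B\<^sup>2"
    unfolding norm_ell2_square hk by (rule infsum_le_finite_sums[OF summ]) (use bd in auto)
  then have nh: "norm h \<le> ?B" by (rule power2_le_imp_le) simp
  have re: "inner (blinfun_apply a f) g = inner f h" for f
  proof -
    have bl: "bounded_linear (\<lambda>f. inner (blinfun_apply a f) g)"
      by (rule bounded_linear_compose[OF bounded_linear_inner_left blinfun.bounded_linear_right])
    have 1: "((\<lambda>x. inner (blinfun_apply a (ell2_scale (ell2_fun f x) (ell2_basis x))) g)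
        has_sum inner (blinfun_apply a f) g) UNIV"
      using has_sum_bounded_linear[OF bl ell2_basis_has_sum[of f]] by (simp add: o_def)
    have 2: "((\<lambda>x. inner (ell2_scale (ell2_fun f x) (ell2_basis x)) h) has_sum inner f h) UNIV"
      using has_sum_bounded_linear[OF bounded_linear_inner_left ell2_basis_has_sum[of f]]
      by (simp add: o_def)
    have "inner (blinfun_apply a (ell2_scale c (ell2_basis x))) g
        = inner (ell2_scale c (ell2_basis x)) h" for c x
      by (simp add: inner_ell2_def lin ell2_inner_scale_left[of _ "blinfun_apply _ _"]
          ell2_inner_basis_left hk k_def ell2_inner_cnj)
    with 1 2 show ?thesis by (metis (no_types, lifting) has_sum_cong has_sum_unique)
  qed
  have "ell2_inner (blinfun_apply a f) g = ell2_inner f h" for f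
    unfolding ell2_inner_eq_inner by (simp add: re flip: lin)
  then show ?thesis using nh that by blast
qed

lemma adjoint_op_exists_unique:
  assumes a: "a \<in> ell2_operators"
  shows "\<exists>!b. \<forall>f g. ell2_inner (blinfun_apply a f) g = ell2_inner f (blinfun_apply b g)"
proof -
  have "\<exists>h. (\<forall>f. ell2_inner (blinfun_apply a f) g = ell2_inner f h) \<and> norm h \<le> norm a * norm g" for g
    by (rule ell2_operator_adjoint_vector[OF a, of g]) blast
  then have "\<exists>H. \<forall>g. (\<forall>f. ell2_inner (blinfun_apply a f) g = ell2_inner f (H g)) \<and>
      norm (H g) \<le> norm a * norm g"
    by (intro choice allI)
  then obtain H where H: "\<And>f g. ell2_inner (blinfun_apply a f) g = ell2_inner f (H g)"
    and nH: "\<And>g. norm (H g) \<le> norm a * norm g"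
    by blast
  have inn: "inner f (H g) = inner (blinfun_apply a f) g" for f g
    by (simp add: inner_ell2_def H)
  have eqI: "x = y" if "\<And>f :: 'a ell2. inner f x = inner f y" for x y :: "'a ell2"
  proof -
    have "inner (x - y) (x - y) = 0"
      using that[of "x - y"] by (simp only: inner_diff_right[of "x - y" x y])
    then show ?thesis by simp
  qed
  have "bounded_linear H"
  proof (rule bounded_linear_intro)
    show "H (x + y) = H x + H y" for x y
      by (rule eqI) (simp add: inn inner_add_right)
    show "H (r *\<^sub>R x) = r *\<^sub>R H x" for r x
      by (rule eqI) (simp add: inn)
    show "norm (H x) \<le> norm x * norm a" for x
      using nH[of x] by (simp add: mult.commute)
  qed
  then have app: "blinfun_apply (Blinfun H) = H" by (rule bounded_linear_Blinfun_apply)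
  show ?thesis
  proof (rule ex1I[of _ "Blinfun H"])
    show "\<forall>f g. ell2_inner (blinfun_apply a f) g = ell2_inner f (blinfun_apply (Blinfun H) g)"
      by (simp add: app H)
    fix b assume b: "\<forall>f g. ell2_inner (blinfun_apply a f) g = ell2_inner f (blinfun_apply b g)"
    show "b = Blinfun H"
    proof (rule blinfun_eqI)
      fix g show "blinfun_apply b g = blinfun_apply (Blinfun H) g"
        unfolding app by (rule ell2_inner_right_unique) (simp add: b[rule_format, symmetric] H)
    qed
  qed
qed

lemma adjoint_op:
  assumes "a \<in> ell2_operators"
  shows "ell2_inner (blinfun_apply a f) g = ell2_inner f (blinfun_apply (adjoint_op a) g)"
  unfolding adjoint_op_def by (rule theI'[OF adjoint_op_exists_unique[OF assms], THEN spec, THEN spec])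


section \<open>Uniform Roe algebras\<close>

definition finite_propagation :: "('a::metric_space ell2 \<Rightarrow>\<^sub>L 'a ell2) \<Rightarrow> bool" where
  "finite_propagation a \<longleftrightarrow>
     (\<exists>r>0. \<forall>x y. dist x y > r \<longrightarrow>
        ell2_inner (blinfun_apply a (ell2_basis x)) (ell2_basis y) = 0)"

definition uniform_roe_algebra :: "('a::metric_space ell2 \<Rightarrow>\<^sub>L 'a ell2) set" where
  "uniform_roe_algebra = closure {a \<in> ell2_operators. finite_propagation a}"

definition star_isomorphism ::
  "('a ell2 \<Rightarrow>\<^sub>L 'a ell2) set \<Rightarrow> ('b ell2 \<Rightarrow>\<^sub>L 'b ell2) set \<Rightarrow>
   (('a ell2 \<Rightarrow>\<^sub>L 'a ell2) \<Rightarrow> ('b ell2 \<Rightarrow>\<^sub>L 'b ell2)) \<Rightarrow> bool" where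
  "star_isomorphism A B \<Phi> \<longleftrightarrow> bij_betw \<Phi> A B \<and>
     (\<forall>a\<in>A. \<forall>b\<in>A. \<Phi> (a + b) = \<Phi> a + \<Phi> b) \<and>
     (\<forall>c. \<forall>a\<in>A. \<Phi> (op_scale c a) = op_scale c (\<Phi> a)) \<and>
     (\<forall>a\<in>A. \<forall>b\<in>A. \<Phi> (a o\<^sub>L b) = \<Phi> a o\<^sub>L \<Phi> b) \<and>
     (\<forall>a\<in>A. \<Phi> (adjoint_op a) = adjoint_op (\<Phi> a))"

definition star_isomorphic ::
  "('a ell2 \<Rightarrow>\<^sub>L 'a ell2) set \<Rightarrow> ('b ell2 \<Rightarrow>\<^sub>L 'b ell2) set \<Rightarrow> bool" where
  "star_isomorphic A B \<longleftrightarrow> (\<exists>\<Phi>. star_isomorphism A B \<Phi>)"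

end

theory Submission
  imports Defs
begin

text \<open>The isomorphism is implemented by a unitary \<open>u\<close>, with inverse \<open>v\<close>, between the two Hilbert spaces
  (\<open>star_isomorphism_spatial\<close>), because the algebras contain all rank-one operators. The coarse
  equivalence is read off from the matrix of \<open>u\<close>: a point \<open>x\<close> is sent to a point \<open>y\<close> at which the
  vector \<open>u \<delta>\<^sub>x\<close> has an entry that is bounded below by a constant independent of \<open>x\<close>.

  Everything rests on one uniformity principle (\<open>uniform_tails\<close>). Conjugating by \<open>u\<close> the 0-1 matrices
  supported on sets \<open>A\<close> of pairs at distance at most \<open>r\<close> gives operators in the other uniform Roe
  algebra, whose columns are therefore small away from the diagonal; a Baire category argument over
  all sets \<open>A\<close> produces a single radius that works for every \<open>A\<close>.

  With diagonal sets \<open>A\<close> the principle yields the lower bound on the entries (\<open>large_entries\<close>). If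
  \<open>u \<delta>\<^sub>x\<close> were spread thinly, it could be cut into two orthogonal pieces whose
  images under \<open>v\<close> nearly agree on a ball around \<open>x\<close>, by a choice of signs, and nearly vanish outside
  it, by uniformity. This is impossible, as \<open>v\<close> preserves the distance of the pieces. With
  singletons \<open>A\<close> the principle says that large entries of \<open>u\<close> at nearby points sit at nearby
  positions (\<open>large_entries_controlled\<close>), which gives at once that the two maps are coarse and that they
  are inverse to each other up to bounded error.\<close>

section \<open>Vectors in the Hilbert space\<close>

lemma ell2_fun_add: "ell2_fun (f + g) x = ell2_fun f x + ell2_fun g x"
  by (simp add: plus_ell2.rep_eq)

lemma ell2_fun_diff: "ell2_fun (f - g) x = ell2_fun f x - ell2_fun g x"
  by (simp add: minus_ell2.rep_eq)

lemma ell2_fun_scale: "ell2_fun (ell2_scale c f) x = c * ell2_fun f x"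
  by (simp add: ell2_scale.rep_eq)

lemma ell2_eqI: "(\<And>x. ell2_fun f x = ell2_fun g x) \<Longrightarrow> f = g"
  by (metis ell2_fun_inject ext)

lemma ell2_inner_add_right: "ell2_inner h (f + g) = ell2_inner h f + ell2_inner h g"
  by (metis complex_cnj_add ell2_inner_add_left ell2_inner_cnj)

lemma ell2_inner_scale_right: "ell2_inner h (ell2_scale c f) = cnj c * ell2_inner h f"
  by (metis complex_cnj_mult ell2_inner_scale_left ell2_inner_cnj)

lemma ell2_inner_norm: "ell2_inner f f = complex_of_real ((norm f)\<^sup>2)"
  by (simp add: ell2_inner_self norm_ell2_square)

lemma ell2_scale_one: "ell2_scale 1 f = f"
  by (rule ell2_eqI) (simp add: ell2_fun_scale)

lemma ell2_scale_scale: "ell2_scale c (ell2_scale d f) = ell2_scale (c * d) f"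
  by (rule ell2_eqI) (simp add: ell2_fun_scale)

lemma ell2_inner_basis: "ell2_inner f (ell2_basis x) = ell2_fun f x"
  using ell2_inner_basis_left[of 1 x f]
  by (metis complex_cnj_cnj ell2_inner_cnj ell2_scale_one mult_1)

lemma norm_ell2_basis [simp]: "norm (ell2_basis x) = 1"
proof -
  have "(norm (ell2_basis x))\<^sup>2 = (\<Sum>\<^sub>\<infinity>y\<in>{x}. 1)"
    unfolding norm_ell2_square by (rule infsum_cong_neutral) (auto simp: ell2_basis.rep_eq)
  then show ?thesis by (simp add: power2_eq_1_iff) (metis norm_ge_zero not_one_le_zero neg_0_le_iff_le)
qed

text \<open>The inherited Cauchy--Schwarz inequality bounds the real part of the complex inner product;
  rotating one of the vectors by a phase gives the bound on the modulus.\<close>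

lemma ell2_cauchy_schwarz: "cmod (ell2_inner f g) \<le> norm f * norm g"
proof (cases "ell2_inner f g = 0")
  case False
  define z where "z = ell2_inner f g"
  define c where "c = cnj z / complex_of_real (cmod z)"
  have z: "z \<noteq> 0" using False by (simp add: z_def)
  have c: "cmod c = 1" using z by (simp add: c_def norm_divide)
  have "c * z = complex_of_real (cmod z)"
    using z by (simp add: c_def mult.commute[of "cnj z"] complex_norm_square[symmetric] power2_eq_square)
  then have "inner (ell2_scale c f) g = cmod z"
    by (simp add: inner_ell2_def ell2_inner_scale_left z_def)
  then show ?thesis
    using norm_cauchy_schwarz[of "ell2_scale c f" g] c by (simp add: norm_ell2_scale z_def)
qed simp

lemma ell2_fun_le_norm: "cmod (ell2_fun f x) \<le> norm f"
  using ell2_cauchy_schwarz[of f "ell2_basis x"] by (simp add: ell2_inner_basis)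

lemma ell2_cut_closed:
  assumes "(\<lambda>x. (cmod (f x))\<^sup>2) summable_on UNIV"
  shows "(\<lambda>x. (cmod (if x \<in> S then f x else 0))\<^sup>2) summable_on UNIV"
  by (rule summable_on_comparison_test[OF assms]) auto

lift_definition ell2_cut :: "'a set \<Rightarrow> 'a ell2 \<Rightarrow> 'a ell2" is "\<lambda>S f x. if x \<in> S then f x else 0"
  by (simp only: mem_Collect_eq ell2_cut_closed)

lemma ell2_fun_cut: "ell2_fun (ell2_cut S f) x = (if x \<in> S then ell2_fun f x else 0)"
  by (simp add: ell2_cut.rep_eq)

lemma ell2_cut_diff: "ell2_cut S (f - g) = ell2_cut S f - ell2_cut S g"
  by (rule ell2_eqI) (simp add: ell2_fun_cut ell2_fun_diff)

lemma ell2_cut_add: "ell2_cut S (f + g) = ell2_cut S f + ell2_cut S g"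
  by (rule ell2_eqI) (simp add: ell2_fun_cut ell2_fun_add)

lemma ell2_cut_split: "f = ell2_cut S f + ell2_cut (- S) f"
  by (rule ell2_eqI) (simp add: ell2_fun_cut ell2_fun_add)

lemma ell2_cut_mono_norm:
  assumes "S \<subseteq> T"
  shows "norm (ell2_cut S f) \<le> norm (ell2_cut T f)"
proof -
  have "(norm (ell2_cut S f))\<^sup>2 \<le> (norm (ell2_cut T f))\<^sup>2"
    unfolding norm_ell2_square
    by (rule infsum_mono)
       (use assms ell2_fun[of "ell2_cut S f"] ell2_fun[of "ell2_cut T f"] in \<open>auto simp: ell2_fun_cut\<close>)
  then show ?thesis by (rule power2_le_imp_le) simp
qed

lemma norm_ell2_cut_le: "norm (ell2_cut S f) \<le> norm f"
proof -
  have "ell2_cut UNIV f = f" by (rule ell2_eqI) (simp add: ell2_fun_cut)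
  then show ?thesis using ell2_cut_mono_norm[of S UNIV f] by simp
qed

lemma norm_ell2_cut_finite:
  assumes "finite G"
  shows "(norm (ell2_cut G f))\<^sup>2 = (\<Sum>x\<in>G. (cmod (ell2_fun f x))\<^sup>2)"
proof -
  have "(norm (ell2_cut G f))\<^sup>2 = (\<Sum>\<^sub>\<infinity>x\<in>G. (cmod (ell2_fun f x))\<^sup>2)"
    unfolding norm_ell2_square by (rule infsum_cong_neutral) (auto simp: ell2_fun_cut)
  then show ?thesis using assms by simp
qed

lemma ell2_cut_eq_sum:
  assumes "finite G"
  shows "ell2_cut G f = (\<Sum>x\<in>G. ell2_scale (ell2_fun f x) (ell2_basis x))"
  by (rule ell2_eqI) (simp add: ell2_fun_cut ell2_fun_sum_basis[OF assms])

lemma ell2_finite_approximation: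
  assumes "0 < e"
  obtains G where "finite G" "norm (f - ell2_cut G f) < e"
proof -
  have "\<forall>\<^sub>F G in finite_subsets_at_top UNIV.
      dist (\<Sum>x\<in>G. ell2_scale (ell2_fun f x) (ell2_basis x)) f < e"
    using ell2_basis_has_sum[of f] assms unfolding has_sum_def by (rule tendstoD)
  then obtain G where "finite G" "dist (\<Sum>x\<in>G. ell2_scale (ell2_fun f x) (ell2_basis x)) f < e"
    unfolding eventually_finite_subsets_at_top by blast
  then show ?thesis
    using that by (metis dist_norm dist_commute ell2_cut_eq_sum)
qed


section \<open>Rank-one operators and the uniform Roe algebra\<close>

definition rank_one :: "'a ell2 \<Rightarrow> 'a ell2 \<Rightarrow> ('a ell2 \<Rightarrow>\<^sub>L 'a ell2)" where
  "rank_one \<xi> \<zeta> = Blinfun (\<lambda>f. ell2_scale (ell2_inner f \<zeta>) \<xi>)"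

lemma rank_one_apply: "blinfun_apply (rank_one \<xi> \<zeta>) f = ell2_scale (ell2_inner f \<zeta>) \<xi>"
  unfolding rank_one_def
proof (subst bounded_linear_Blinfun_apply)
  show "bounded_linear (\<lambda>f. ell2_scale (ell2_inner f \<zeta>) \<xi>)"
  proof (rule bounded_linear_intro)
    show "ell2_scale (ell2_inner (f + g) \<zeta>) \<xi>
        = ell2_scale (ell2_inner f \<zeta>) \<xi> + ell2_scale (ell2_inner g \<zeta>) \<xi>" for f g
      by (rule ell2_eqI) (simp add: ell2_fun_scale ell2_fun_add ell2_inner_add_left distrib_right)
    show "ell2_scale (ell2_inner (r *\<^sub>R f) \<zeta>) \<xi> = r *\<^sub>R ell2_scale (ell2_inner f \<zeta>) \<xi>" for r f
      by (simp add: scaleR_ell2_eq ell2_inner_scale_left ell2_scale_scale)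
    show "norm (ell2_scale (ell2_inner f \<zeta>) \<xi>) \<le> norm f * (norm \<zeta> * norm \<xi>)" for f
      using mult_right_mono[OF ell2_cauchy_schwarz[of f \<zeta>] norm_ge_zero[of \<xi>]]
      by (simp add: norm_ell2_scale mult.assoc)
  qed
qed simp

lemma rank_one_operator: "rank_one \<xi> \<zeta> \<in> ell2_operators"
  by (simp add: ell2_operators_def rank_one_apply ell2_inner_scale_left ell2_scale_scale)

lemma rank_one_diff_bound:
  "norm (rank_one \<xi> \<zeta> - rank_one \<xi>' \<zeta>') \<le> norm (\<xi> - \<xi>') * norm \<zeta> + norm \<xi>' * norm (\<zeta> - \<zeta>')"
proof (rule norm_blinfun_bound)
  fix f
  have "blinfun_apply (rank_one \<xi> \<zeta> - rank_one \<xi>' \<zeta>') f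
      = ell2_scale (ell2_inner f \<zeta>) (\<xi> - \<xi>') + ell2_scale (ell2_inner f (\<zeta> - \<zeta>')) \<xi>'"
  proof (rule ell2_eqI)
    fix x
    have "ell2_inner f \<zeta> = ell2_inner f (\<zeta> - \<zeta>') + ell2_inner f \<zeta>'"
      by (metis diff_add_cancel ell2_inner_add_right)
    then show "ell2_fun (blinfun_apply (rank_one \<xi> \<zeta> - rank_one \<xi>' \<zeta>') f) x
        = ell2_fun (ell2_scale (ell2_inner f \<zeta>) (\<xi> - \<xi>') + ell2_scale (ell2_inner f (\<zeta> - \<zeta>')) \<xi>') x"
      by (simp add: blinfun.diff_left rank_one_apply ell2_fun_diff ell2_fun_scale ell2_fun_add algebra_simps)
  qed
  also have "norm \<dots> \<le> cmod (ell2_inner f \<zeta>) * norm (\<xi> - \<xi>') + cmod (ell2_inner f (\<zeta> - \<zeta>')) * norm \<xi>'"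
    using norm_triangle_ineq[of "ell2_scale (ell2_inner f \<zeta>) (\<xi> - \<xi>')"]
    by (metis norm_ell2_scale)
  also have "\<dots> \<le> (norm f * norm \<zeta>) * norm (\<xi> - \<xi>') + (norm f * norm (\<zeta> - \<zeta>')) * norm \<xi>'"
    by (intro add_mono mult_right_mono ell2_cauchy_schwarz) auto
  finally show "norm (blinfun_apply (rank_one \<xi> \<zeta> - rank_one \<xi>' \<zeta>') f)
      \<le> (norm (\<xi> - \<xi>') * norm \<zeta> + norm \<xi>' * norm (\<zeta> - \<zeta>')) * norm f"
    by (simp add: algebra_simps)
qed simp

lemma rank_one_finite_propagation:
  fixes \<xi> \<zeta> :: "'a::metric_space ell2"
  assumes "finite F" "finite G"
  shows "finite_propagation (rank_one (ell2_cut F \<xi>) (ell2_cut G \<zeta>))"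
proof -
  have fin: "finite ((\<lambda>(x, y). dist x y) ` (G \<times> F))" using assms by simp
  obtain r where r: "\<forall>t\<in>(\<lambda>(x, y). dist x y) ` (G \<times> F). t \<le> r"
    using bdd_above_finite[OF fin] unfolding bdd_above_def by blast
  have "ell2_inner (blinfun_apply (rank_one (ell2_cut F \<xi>) (ell2_cut G \<zeta>)) (ell2_basis x))
      (ell2_basis y) = 0" if "dist x y > max r 1" for x y
  proof -
    have "x \<notin> G \<or> y \<notin> F" using r that by force
    moreover have "ell2_inner (ell2_basis x) (ell2_cut G \<zeta>) = cnj (ell2_fun (ell2_cut G \<zeta>) x)"
      by (metis ell2_inner_basis ell2_inner_cnj)
    ultimately show ?thesis
      by (auto simp: ell2_inner_basis rank_one_apply ell2_fun_scale ell2_fun_cut)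
  qed
  then show ?thesis unfolding finite_propagation_def
    by (intro exI[of _ "max r 1"]) auto
qed

text \<open>Truncating both vectors to finite sets gives an operator with only finitely many nonzero matrix
  entries, hence of finite propagation, at a small distance in norm.\<close>

lemma rank_one_in_roe: "rank_one \<xi> \<zeta> \<in> (uniform_roe_algebra :: ('a::metric_space ell2 \<Rightarrow>\<^sub>L 'a ell2) set)"
  unfolding uniform_roe_algebra_def closure_approachable
proof (intro allI impI)
  fix e :: real assume e: "0 < e"
  define K where "K = norm \<xi> + norm \<zeta> + 1"
  have K: "K > 0" unfolding K_def by (metis add_nonneg_pos add_nonneg_nonneg norm_ge_zero zero_less_one)
  then have eK: "e / (2 * K) > 0" using e by simp
  obtain F where F: "finite F" "norm (\<xi> - ell2_cut F \<xi>) < e / (2 * K)"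
    using ell2_finite_approximation[OF eK] .
  obtain G where G: "finite G" "norm (\<zeta> - ell2_cut G \<zeta>) < e / (2 * K)"
    using ell2_finite_approximation[OF eK] .
  have "norm (rank_one \<xi> \<zeta> - rank_one (ell2_cut F \<xi>) (ell2_cut G \<zeta>))
      \<le> norm (\<xi> - ell2_cut F \<xi>) * norm \<zeta> + norm (ell2_cut F \<xi>) * norm (\<zeta> - ell2_cut G \<zeta>)"
    by (rule rank_one_diff_bound)
  also have "\<dots> \<le> e / (2 * K) * norm \<zeta> + norm \<xi> * (e / (2 * K))"
    using F G eK by (intro add_mono mult_mono norm_ell2_cut_le) auto
  also have "\<dots> = e / (2 * K) * (norm \<zeta> + norm \<xi>)" by (simp only: distrib_left mult.commute[of "norm \<xi>"])
  also have "\<dots> < e / (2 * K) * K"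
    using eK by (intro mult_strict_left_mono) (auto simp: K_def)
  also have "\<dots> < e" using K e by simp
  finally have "dist (rank_one (ell2_cut F \<xi>) (ell2_cut G \<zeta>)) (rank_one \<xi> \<zeta>) < e"
    by (simp add: dist_norm norm_minus_commute)
  then show "\<exists>b\<in>{a \<in> ell2_operators. finite_propagation a}. dist b (rank_one \<xi> \<zeta>) < e"
    using rank_one_operator rank_one_finite_propagation[OF F(1) G(1)] by blast
qed

lemma closed_ell2_operators: "closed (ell2_operators :: ('a ell2 \<Rightarrow>\<^sub>L 'a ell2) set)"
proof -
  have "closed {a :: 'a ell2 \<Rightarrow>\<^sub>L 'a ell2.
      blinfun_apply a (ell2_scale c f) = ell2_scale c (blinfun_apply a f)}" for c f
    by (intro closed_Collect_eq linear_continuous_on blinfun.bounded_linear_left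
        bounded_linear_compose[OF bounded_linear_ell2_scale])
  then have "closed (\<Inter>c. \<Inter>f. {a :: 'a ell2 \<Rightarrow>\<^sub>L 'a ell2.
      blinfun_apply a (ell2_scale c f) = ell2_scale c (blinfun_apply a f)})"
    by (intro closed_INT ballI)
  also have "(\<Inter>c. \<Inter>f. {a :: 'a ell2 \<Rightarrow>\<^sub>L 'a ell2.
      blinfun_apply a (ell2_scale c f) = ell2_scale c (blinfun_apply a f)}) = ell2_operators"
    by (auto simp: ell2_operators_def)
  finally show ?thesis .
qed

lemma roe_subset_operators: "uniform_roe_algebra \<subseteq> ell2_operators"
  unfolding uniform_roe_algebra_def by (rule closure_minimal[OF _ closed_ell2_operators]) blast

lemma finite_propagation_in_roe:
  "a \<in> ell2_operators \<Longrightarrow> finite_propagation a \<Longrightarrow> a \<in> uniform_roe_algebra"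
  unfolding uniform_roe_algebra_def by (rule subsetD[OF closure_subset]) simp

lemma adjoint_rank_one: "adjoint_op (rank_one \<xi> \<zeta>) = rank_one \<zeta> \<xi>"
proof -
  have "ell2_inner (blinfun_apply (rank_one \<xi> \<zeta>) f) g = ell2_inner f (blinfun_apply (rank_one \<zeta> \<xi>) g)" for f g
    by (simp add: rank_one_apply ell2_inner_scale_left ell2_inner_scale_right ell2_inner_cnj)
  then show ?thesis
    unfolding adjoint_op_def
    by (intro the1_equality[OF adjoint_op_exists_unique[OF rank_one_operator]] allI)
qed

section \<open>Isomorphisms are implemented by unitaries\<close>

lemma operator_comp_rank_one:
  assumes "T \<in> ell2_operators"
  shows "T o\<^sub>L rank_one \<xi> \<zeta> = rank_one (blinfun_apply T \<xi>) \<zeta>"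
  by (rule blinfun_eqI) (use assms in \<open>simp add: rank_one_apply ell2_operators_def\<close>)

lemma rank_one_comp_rank_one:
  "rank_one \<xi> \<zeta> o\<^sub>L rank_one \<xi>' \<zeta>' = op_scale (ell2_inner \<xi>' \<zeta>) (rank_one \<xi> \<zeta>')"
  by (rule blinfun_eqI)
     (simp add: rank_one_apply op_scale_apply ell2_inner_scale_left ell2_scale_scale mult.commute)

text \<open>The pair of mutually adjoint inverses is kept explicit, so that the notion is visibly symmetric
  and every statement about \<open>u\<close> applies to \<open>v\<close> as well. Linearity and isometry follow from
  the adjoint relation.\<close>

definition roe_unitary :: "('a::metric_space ell2 \<Rightarrow> 'b::metric_space ell2) \<Rightarrow> ('b ell2 \<Rightarrow> 'a ell2) \<Rightarrow> bool" where
  "roe_unitary u v \<longleftrightarrow>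
     (\<forall>f g. ell2_inner (u f) g = ell2_inner f (v g)) \<and> (\<forall>f. v (u f) = f) \<and> (\<forall>g. u (v g) = g) \<and>
     (\<forall>T\<in>uniform_roe_algebra. \<exists>S\<in>uniform_roe_algebra. \<forall>g. blinfun_apply S g = u (blinfun_apply T (v g))) \<and>
     (\<forall>S\<in>uniform_roe_algebra. \<exists>T\<in>uniform_roe_algebra. \<forall>f. blinfun_apply T f = v (blinfun_apply S (u f)))"

lemma roe_unitary_sym:
  assumes "roe_unitary u v"
  shows "roe_unitary v u"
proof -
  have "ell2_inner (v g) f = ell2_inner g (u f)" for f g
    using assms unfolding roe_unitary_def by (metis ell2_inner_cnj)
  then show ?thesis using assms unfolding roe_unitary_def by simp
qed

lemma roe_unitary_inner: "roe_unitary u v \<Longrightarrow> ell2_inner (u f) g = ell2_inner f (v g)"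
  by (simp add: roe_unitary_def)

lemma roe_unitary_inverse: "roe_unitary u v \<Longrightarrow> v (u f) = f"
  by (simp add: roe_unitary_def)

lemma roe_unitary_add:
  assumes "roe_unitary u v"
  shows "u (f + g) = u f + u g"
  by (rule ell2_inner_right_unique)
     (simp add: ell2_inner_add_right roe_unitary_inner[OF roe_unitary_sym[OF assms], symmetric])

lemma roe_unitary_scale:
  assumes "roe_unitary u v"
  shows "u (ell2_scale c f) = ell2_scale c (u f)"
  by (rule ell2_inner_right_unique)
     (simp add: ell2_inner_scale_right roe_unitary_inner[OF roe_unitary_sym[OF assms], symmetric])

lemma roe_unitary_diff:
  assumes "roe_unitary u v"
  shows "u (f - g) = u f - u g"
  using roe_unitary_add[OF assms, of "f - g" g] by simp

lemma roe_unitary_norm: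
  assumes "roe_unitary u v"
  shows "norm (u f) = norm f"
proof -
  have "complex_of_real ((norm (u f))\<^sup>2) = complex_of_real ((norm f)\<^sup>2)"
    using assms by (simp only: ell2_inner_norm[symmetric] roe_unitary_inner roe_unitary_inverse)
  then have "(norm (u f))\<^sup>2 = (norm f)\<^sup>2" by (simp only: of_real_eq_iff)
  then show ?thesis by (simp add: power2_eq_iff_nonneg)
qed

lemma roe_unitary_entry:
  assumes "roe_unitary u v"
  shows "ell2_fun (v (ell2_basis y)) x = cnj (ell2_fun (u (ell2_basis x)) y)"
  by (metis assms ell2_inner_basis ell2_inner_cnj roe_unitary_inner)

text \<open>Every isomorphism is spatial. Fix a unit vector \<open>\<delta>\<close> and a unit vector \<open>\<eta>\<close> in the range of the
  nonzero projection \<open>\<Phi> (rank_one \<delta> \<delta>)\<close>; the unitary sends \<open>\<xi>\<close> to \<open>\<Phi> (rank_one \<xi> \<delta>) \<eta>\<close>.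
  It preserves inner products since \<open>\<Phi>\<close> respects products and adjoints of rank-one operators,
  and it is onto because \<open>rank_one \<zeta> \<eta>\<close> has a preimage \<open>S\<close>, which maps \<open>\<delta>\<close> to a vector that is
  sent to \<open>\<zeta>\<close>. Evaluating \<open>\<Phi> (T o\<^sub>L rank_one \<xi> \<delta>) = \<Phi> T o\<^sub>L \<Phi> (rank_one \<xi> \<delta>)\<close> at \<open>\<eta>\<close>
  shows that the unitary intertwines \<open>T\<close> with \<open>\<Phi> T\<close>.\<close>

lemma star_isomorphism_spatial:
  fixes \<Phi> :: "('a::metric_space ell2 \<Rightarrow>\<^sub>L 'a ell2) \<Rightarrow> ('b::metric_space ell2 \<Rightarrow>\<^sub>L 'b ell2)"
  assumes "star_isomorphism uniform_roe_algebra uniform_roe_algebra \<Phi>"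
  obtains u v where "roe_unitary (u :: 'a ell2 \<Rightarrow> 'b ell2) v"
proof -
  let ?A = "uniform_roe_algebra :: ('a ell2 \<Rightarrow>\<^sub>L 'a ell2) set"
  let ?B = "uniform_roe_algebra :: ('b ell2 \<Rightarrow>\<^sub>L 'b ell2) set"
  have bij: "bij_betw \<Phi> ?A ?B"
    and add: "\<And>a b. a \<in> ?A \<Longrightarrow> b \<in> ?A \<Longrightarrow> \<Phi> (a + b) = \<Phi> a + \<Phi> b"
    and scale: "\<And>c a. a \<in> ?A \<Longrightarrow> \<Phi> (op_scale c a) = op_scale c (\<Phi> a)"
    and mult: "\<And>a b. a \<in> ?A \<Longrightarrow> b \<in> ?A \<Longrightarrow> \<Phi> (a o\<^sub>L b) = \<Phi> a o\<^sub>L \<Phi> b"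
    and adj: "\<And>a. a \<in> ?A \<Longrightarrow> \<Phi> (adjoint_op a) = adjoint_op (\<Phi> a)"
    using assms unfolding star_isomorphism_def by auto
  have img: "\<Phi> a \<in> ?B" if "a \<in> ?A" for a using bij that by (auto simp: bij_betw_def)
  define \<delta> :: "'a ell2" where "\<delta> = ell2_basis undefined"
  define p where "p = rank_one \<delta> \<delta>"
  have pA: "p \<in> ?A" by (simp add: p_def rank_one_in_roe)
  have dd: "ell2_inner \<delta> \<delta> = 1" by (simp add: ell2_inner_norm \<delta>_def)
  have pp: "p o\<^sub>L p = p"
    by (rule blinfun_eqI) (simp add: p_def rank_one_apply ell2_inner_scale_left dd)
  have zero: "rank_one 0 0 = (0 :: 'a ell2 \<Rightarrow>\<^sub>L 'a ell2)"
    by (rule blinfun_eqI, rule ell2_eqI) (simp add: rank_one_apply ell2_fun_scale zero_ell2.rep_eq)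
  have zA: "0 \<in> ?A" using rank_one_in_roe[of "0 :: 'a ell2" 0] by (simp add: zero)
  have "p \<noteq> 0"
  proof
    assume "p = 0"
    then have "blinfun_apply p \<delta> = 0" by simp
    then have "\<delta> = 0" by (simp add: p_def rank_one_apply dd ell2_scale_one)
    then show False by (metis \<delta>_def norm_ell2_basis norm_zero zero_neq_one)
  qed
  moreover have "\<Phi> 0 = 0" using add[OF zA zA] by simp
  ultimately have "\<Phi> p \<noteq> 0"
    using bij pA zA unfolding bij_betw_def by (metis inj_onD)
  then obtain w where w: "blinfun_apply (\<Phi> p) w \<noteq> 0"
    by (metis blinfun_eqI zero_blinfun.rep_eq)
  define \<eta> where "\<eta> = blinfun_apply (\<Phi> p) w /\<^sub>R norm (blinfun_apply (\<Phi> p) w)"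
  have p\<eta>: "blinfun_apply (\<Phi> p) \<eta> = \<eta>"
    using mult[OF pA pA] unfolding \<eta>_def pp
    by (metis blinfun_apply_blinfun_compose blinfun.scaleR_right)
  have "norm \<eta> = 1" using w by (simp add: \<eta>_def)
  then have \<eta>\<eta>: "ell2_inner \<eta> \<eta> = 1" by (simp add: ell2_inner_norm)

  define u where "u \<xi> = blinfun_apply (\<Phi> (rank_one \<xi> \<delta>)) \<eta>" for \<xi>
  have uinner: "ell2_inner (u \<xi>) (u \<zeta>) = ell2_inner \<xi> \<zeta>" for \<xi> \<zeta>
  proof -
    have op: "\<Phi> (rank_one \<zeta> \<delta>) \<in> ell2_operators"
      using img[OF rank_one_in_roe] roe_subset_operators by blast
    have ad: "adjoint_op (\<Phi> (rank_one \<zeta> \<delta>)) = \<Phi> (rank_one \<delta> \<zeta>)"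
      by (simp add: adj[OF rank_one_in_roe, symmetric] adjoint_rank_one)
    have "blinfun_apply (\<Phi> (rank_one \<delta> \<zeta>)) (u \<xi>) = blinfun_apply (\<Phi> (rank_one \<delta> \<zeta> o\<^sub>L rank_one \<xi> \<delta>)) \<eta>"
      by (simp add: u_def mult[OF rank_one_in_roe rank_one_in_roe])
    also have "\<dots> = ell2_scale (ell2_inner \<xi> \<zeta>) \<eta>"
      by (simp add: rank_one_comp_rank_one scale[OF rank_one_in_roe] op_scale_apply p\<eta>[unfolded p_def])
    finally have "ell2_inner (u \<zeta>) (u \<xi>) = ell2_inner \<eta> (ell2_scale (ell2_inner \<xi> \<zeta>) \<eta>)"
      using adjoint_op[OF op, of \<eta> "u \<xi>"] by (simp add: ad u_def)
    then show ?thesis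
      by (metis ell2_inner_scale_right \<eta>\<eta> mult.right_neutral ell2_inner_cnj)
  qed
  have inter: "u (blinfun_apply T \<xi>) = blinfun_apply (\<Phi> T) (u \<xi>)" if "T \<in> ?A" for T \<xi>
    using that roe_subset_operators
    by (auto simp: u_def operator_comp_rank_one[symmetric] mult rank_one_in_roe)
  have "inj u"
  proof (rule injI)
    fix f g assume "u f = u g"
    then show "f = g" by (metis uinner ell2_inner_right_unique)
  qed
  have "\<exists>\<xi>. u \<xi> = \<zeta>" for \<zeta>
  proof -
    have "rank_one \<zeta> \<eta> \<in> \<Phi> ` ?A"
      using bij rank_one_in_roe unfolding bij_betw_def by blast
    then obtain S where S: "S \<in> ?A" "\<Phi> S = rank_one \<zeta> \<eta>" by auto
    have "u \<delta> = \<eta>" using p\<eta> by (simp add: u_def p_def)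
    then have "u (blinfun_apply S \<delta>) = \<zeta>"
      by (simp add: inter[OF S(1)] S(2) rank_one_apply \<eta>\<eta> ell2_scale_one)
    then show ?thesis ..
  qed
  then have surj: "surj u" by (metis surjI)
  define v where "v = inv u"
  have uv: "u (v \<zeta>) = \<zeta>" for \<zeta> using surj by (simp add: v_def surj_f_inv_f)
  have vu: "v (u \<xi>) = \<xi>" for \<xi> using \<open>inj u\<close> by (simp add: v_def)
  have "roe_unitary u v"
    unfolding roe_unitary_def
  proof (intro conjI allI ballI)
    show "ell2_inner (u f) g = ell2_inner f (v g)" for f g by (metis uinner uv)
    show "v (u f) = f" for f by (rule vu)
    show "u (v g) = g" for g by (rule uv)
    show "\<exists>S\<in>?B. \<forall>g. blinfun_apply S g = u (blinfun_apply T (v g))" if "T \<in> ?A" for T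
      using img[OF that] inter[OF that] uv by (intro bexI[of _ "\<Phi> T"]) auto
    show "\<exists>T\<in>?A. \<forall>f. blinfun_apply T f = v (blinfun_apply S (u f))" if S: "S \<in> ?B" for S
    proof -
      have "S \<in> \<Phi> ` ?A" using S bij by (auto simp: bij_betw_def)
      then obtain T where T: "T \<in> ?A" "S = \<Phi> T" by auto
      have "blinfun_apply T f = v (blinfun_apply S (u f))" for f
        by (simp add: T(2) inter[OF T(1), symmetric] vu)
      then show ?thesis using T(1) by blast
    qed
  qed
  then show ?thesis by (rule that)
qed

section \<open>Band operators\<close>

text \<open>\<open>band_fun r A\<close> is the action of the 0-1 matrix supported on the pairs in \<open>A\<close> that are at distance
  at most \<open>r\<close>. Arbitrary sets \<open>A\<close> are allowed so that all these matrices lie in the uniform Roe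
  algebra at once and depend additively on \<open>A\<close>. The two families of operators that matter are the
  coordinate projections (\<open>A\<close> diagonal) and the matrix units (\<open>A\<close> a singleton).\<close>

definition band_fun :: "real \<Rightarrow> ('a::metric_space \<times> 'a) set \<Rightarrow> 'a ell2 \<Rightarrow> 'a \<Rightarrow> complex" where
  "band_fun r A f x = (\<Sum>x'\<in>cball x r. if (x, x') \<in> A then ell2_fun f x' else 0)"

definition band_op :: "real \<Rightarrow> ('a::metric_space \<times> 'a) set \<Rightarrow> ('a ell2 \<Rightarrow>\<^sub>L 'a ell2)" where
  "band_op r A = Blinfun (\<lambda>f. Abs_ell2 (band_fun r A f))"

text \<open>This is the Schur test: each row and each column of the matrix has at most \<open>N\<close> nonzero
  entries, all of modulus one.\<close>

lemma band_fun_square_bound: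
  fixes f :: "'a::metric_space ell2"
  assumes ulf: "\<And>x :: 'a. finite (cball x r)" "\<And>x :: 'a. card (cball x r) \<le> N" and F: "finite F"
  shows "(\<Sum>x\<in>F. (cmod (band_fun r A f x))\<^sup>2) \<le> (real N * norm f)\<^sup>2"
proof -
  define q where "q x = (cmod (ell2_fun f x))\<^sup>2" for x
  have q0: "0 \<le> q x" for x by (simp add: q_def)
  define K where "K = (\<Union>x\<in>F. cball x r)"
  have K: "finite K" using F ulf by (simp add: K_def)
  have row: "(cmod (band_fun r A f x))\<^sup>2 \<le> real N * (\<Sum>x'\<in>K. if dist x x' \<le> r then q x' else 0)"
    if "x \<in> F" for x
  proof -
    have "cmod (band_fun r A f x) \<le> (\<Sum>x'\<in>cball x r. cmod (ell2_fun f x'))"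
      unfolding band_fun_def by (rule order_trans[OF norm_sum]) (rule sum_mono, simp)
    then have "(cmod (band_fun r A f x))\<^sup>2 \<le> (\<Sum>x'\<in>cball x r. cmod (ell2_fun f x'))\<^sup>2"
      by (rule power_mono) simp
    also have "\<dots> \<le> (\<Sum>x'\<in>cball x r. q x') * real (card (cball x r))"
      unfolding q_def by (rule sum_squared_le_sum_of_squares)
    also have "\<dots> \<le> (\<Sum>x'\<in>cball x r. q x') * real N"
      using ulf(2) by (intro mult_left_mono sum_nonneg q0) simp
    also have "(\<Sum>x'\<in>cball x r. q x') = (\<Sum>x'\<in>K. if dist x x' \<le> r then q x' else 0)"
      using K that by (intro sum.mono_neutral_cong_left) (auto simp: K_def)
    finally show ?thesis by (simp add: mult.commute)
  qed
  have col: "(\<Sum>x\<in>F. if dist x x' \<le> r then q x' else 0) \<le> real N * q x'" for x'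
  proof -
    have "(\<Sum>x\<in>F. if dist x x' \<le> r then q x' else 0) = (\<Sum>x\<in>F \<inter> cball x' r. q x')"
      using F by (intro sum.mono_neutral_cong_right) (auto simp: dist_commute)
    also have "\<dots> = real (card (F \<inter> cball x' r)) * q x'" by simp
    also have "\<dots> \<le> real N * q x'"
      using card_mono[OF ulf(1), of "F \<inter> cball x' r" x'] ulf(2)[of x']
      by (intro mult_right_mono q0) simp
    finally show ?thesis .
  qed
  have "(\<Sum>x\<in>F. (cmod (band_fun r A f x))\<^sup>2)
      \<le> (\<Sum>x\<in>F. real N * (\<Sum>x'\<in>K. if dist x x' \<le> r then q x' else 0))"
    by (rule sum_mono) (rule row)
  also have "\<dots> = real N * (\<Sum>x'\<in>K. \<Sum>x\<in>F. if dist x x' \<le> r then q x' else 0)"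
    unfolding sum_distrib_left[symmetric] by (subst sum.swap) simp
  also have "\<dots> \<le> real N * (\<Sum>x'\<in>K. real N * q x')"
    by (intro mult_left_mono sum_mono col) simp
  also have "\<dots> = (real N)\<^sup>2 * (\<Sum>x'\<in>K. q x')"
    by (simp add: sum_distrib_left[symmetric] power2_eq_square)
  also have "\<dots> \<le> (real N)\<^sup>2 * (norm f)\<^sup>2"
    using norm_ell2_cut_finite[OF K, of f] norm_ell2_cut_le[of K f]
    by (intro mult_left_mono) (auto simp: q_def intro: power_mono simp flip: norm_ell2_cut_finite[OF K])
  finally show ?thesis by (simp add: power_mult_distrib)
qed

lemma
  fixes f :: "'a::metric_space ell2"
  assumes ulf: "\<And>x :: 'a. finite (cball x r)" "\<And>x :: 'a. card (cball x r) \<le> N"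
  shows band_op_fun: "ell2_fun (blinfun_apply (band_op r A) f) x = band_fun r A f x"
    and band_op_norm: "norm (blinfun_apply (band_op r A) f) \<le> real N * norm f"
proof -
  let ?H = "\<lambda>f. Abs_ell2 (band_fun r A f)"
  have summ: "(\<lambda>x. (cmod (band_fun r A f x))\<^sup>2) summable_on UNIV" for f :: "'a ell2"
    by (rule nonneg_bounded_partial_sums_imp_summable_on[where C="(real N * norm f)\<^sup>2"])
       (auto intro!: eventually_finite_subsets_at_top_weakI band_fun_square_bound[OF ulf])
  have H: "ell2_fun (?H f) = band_fun r A f" for f
    by (rule Abs_ell2_inverse) (simp add: summ)
  have nH: "norm (?H f) \<le> real N * norm f" for f
  proof -
    have "(norm (?H f))\<^sup>2 \<le> (real N * norm f)\<^sup>2"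
      unfolding norm_ell2_square H
      by (rule infsum_le_finite_sums[OF summ]) (rule band_fun_square_bound[OF ulf])
    then show ?thesis by (rule power2_le_imp_le) simp
  qed
  have "bounded_linear ?H"
  proof (rule bounded_linear_intro)
    show "?H (f + g) = ?H f + ?H g" for f g
      by (rule ell2_eqI) (auto simp: H ell2_fun_add band_fun_def simp flip: sum.distrib intro: sum.cong)
    show "?H (c *\<^sub>R f) = c *\<^sub>R ?H f" for c f
      by (rule ell2_eqI)
         (auto simp: H ell2_fun_scale scaleR_ell2_eq band_fun_def sum_distrib_left intro: sum.cong)
    show "norm (?H f) \<le> norm f * real N" for f using nH[of f] by (simp add: mult.commute)
  qed
  then have app: "blinfun_apply (band_op r A) = ?H"
    unfolding band_op_def by (rule bounded_linear_Blinfun_apply)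
  show "ell2_fun (blinfun_apply (band_op r A) f) x = band_fun r A f x"
    by (simp add: app H)
  show "norm (blinfun_apply (band_op r A) f) \<le> real N * norm f"
    by (simp add: app nH)
qed

lemma uniformly_locally_finiteE:
  assumes "uniformly_locally_finite TYPE('a::metric_space)" "0 < r"
  obtains N where "\<And>x :: 'a. finite (cball x r)" "\<And>x :: 'a. card (cball x r) \<le> N"
  using assms unfolding uniformly_locally_finite_def by blast

lemma band_op_in_roe:
  assumes "uniformly_locally_finite TYPE('a::metric_space)" "0 < r"
  shows "band_op r A \<in> (uniform_roe_algebra :: ('a ell2 \<Rightarrow>\<^sub>L 'a ell2) set)"
proof -
  obtain N where N: "\<And>x :: 'a. finite (cball x r)" "\<And>x :: 'a. card (cball x r) \<le> N"
    by (rule uniformly_locally_finiteE[OF assms]) blast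
  have "blinfun_apply (band_op r A) (ell2_scale c f) = ell2_scale c (blinfun_apply (band_op r A) f)"
    for c and f :: "'a ell2"
    by (rule ell2_eqI)
       (auto simp: band_op_fun[OF N] ell2_fun_scale band_fun_def sum_distrib_left intro: sum.cong)
  moreover have "ell2_inner (blinfun_apply (band_op r A) (ell2_basis x)) (ell2_basis y) = 0"
    if "dist x y > r" for x y :: 'a
    using that
    by (auto simp: ell2_inner_basis band_op_fun[OF N] band_fun_def ell2_basis.rep_eq dist_commute
        intro!: sum.neutral)
  ultimately show ?thesis
    using assms(2)
    by (intro finite_propagation_in_roe) (auto simp: ell2_operators_def finite_propagation_def)
qed

lemma band_op_diagonal:
  fixes f :: "'a::metric_space ell2"
  assumes "uniformly_locally_finite TYPE('a)" "0 < r"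
  shows "blinfun_apply (band_op r (Id_on C)) f = ell2_cut C f"
proof (rule ell2_eqI)
  fix x
  obtain N where N: "\<And>x :: 'a. finite (cball x r)" "\<And>x :: 'a. card (cball x r) \<le> N"
    by (rule uniformly_locally_finiteE[OF assms]) blast
  have "band_fun r (Id_on C) f x = (\<Sum>x'\<in>cball x r. if x' = x then ell2_fun (ell2_cut C f) x else 0)"
    unfolding band_fun_def by (rule sum.cong) (auto simp: ell2_fun_cut)
  also have "\<dots> = ell2_fun (ell2_cut C f) x" using N assms(2) by simp
  finally show "ell2_fun (blinfun_apply (band_op r (Id_on C)) f) x = ell2_fun (ell2_cut C f) x"
    by (simp add: band_op_fun[OF N])
qed

lemma band_op_singleton:
  fixes f :: "'a::metric_space ell2"
  assumes "uniformly_locally_finite TYPE('a)" "0 < r" "dist x x' \<le> r"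
  shows "blinfun_apply (band_op r {(x, x')}) f = ell2_scale (ell2_fun f x') (ell2_basis x)"
proof (rule ell2_eqI)
  fix z
  obtain N where N: "\<And>x :: 'a. finite (cball x r)" "\<And>x :: 'a. card (cball x r) \<le> N"
    by (rule uniformly_locally_finiteE[OF assms(1,2)]) blast
  have "band_fun r {(x, x')} f z
      = (\<Sum>x''\<in>cball z r. if x'' = x' then (if z = x then ell2_fun f x' else 0) else 0)"
    unfolding band_fun_def by (rule sum.cong) auto
  also have "\<dots> = ell2_fun (ell2_scale (ell2_fun f x') (ell2_basis x)) z"
    using N assms(3) by (simp add: ell2_fun_scale ell2_basis.rep_eq)
  finally show "ell2_fun (blinfun_apply (band_op r {(x, x')}) f) z
      = ell2_fun (ell2_scale (ell2_fun f x') (ell2_basis x)) z"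
    by (simp add: band_op_fun[OF N])
qed

section \<open>Uniform decay of the tails\<close>

text \<open>This is the Baire category theorem in the space of all subsets of the index type with its
  product topology: countably many closed sets cover the space, so one of them contains a basic
  open set, that is, all sets with a prescribed trace \<open>B\<close> on some finite set \<open>F\<close>. If there were no
  such cylinder, one could shrink cylinders successively, the \<open>n\<close>-th step avoiding the \<open>n\<close>-th closed
  set; the cylinders determine a set that belongs to none of the cover.\<close>

lemma uniform_on_cylinder:
  fixes P :: "nat \<Rightarrow> 'i set \<Rightarrow> bool"
  assumes ex: "\<And>A. \<exists>n. P n A"
    and closed: "\<And>n A. (\<And>F. finite F \<Longrightarrow> \<exists>A'. A' \<inter> F = A \<inter> F \<and> P n A') \<Longrightarrow> P n A"
  obtains n F B where "finite F" "B \<subseteq> F" "\<And>A. A \<inter> F = B \<Longrightarrow> P n A"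
proof (rule ccontr)
  note cylinder = that
  assume not: "\<not> thesis"
  have no: "\<exists>A. A \<inter> F = B \<and> \<not> P n A" if "finite F" "B \<subseteq> F" for n F B
  proof (rule ccontr)
    assume none: "\<nexists>A. A \<inter> F = B \<and> \<not> P n A"
    have thesis by (rule cylinder[OF that, of n]) (use none in auto)
    then show False using not by contradiction
  qed
  have step: "\<exists>y. (finite (fst y) \<and> snd y \<subseteq> fst y) \<and>
      (fst x \<subseteq> fst y \<and> snd y \<inter> fst x = snd x \<and> (\<forall>A. A \<inter> fst y = snd y \<longrightarrow> \<not> P n A))"
    if x: "finite (fst x) \<and> snd x \<subseteq> fst x" for x :: "'i set \<times> 'i set" and n
  proof -
    obtain A where A: "A \<inter> fst x = snd x" "\<not> P n A" using no[of "fst x" "snd x" n] x by blast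
    have "\<exists>G. finite G \<and> (\<forall>A'. A' \<inter> G = A \<inter> G \<longrightarrow> \<not> P n A')"
      using closed[of A n] A(2) by blast
    then obtain G where G: "finite G" "\<And>A'. A' \<inter> G = A \<inter> G \<Longrightarrow> \<not> P n A'" by blast
    show ?thesis
    proof (intro exI[of _ "(fst x \<union> G, A \<inter> (fst x \<union> G))"] conjI allI impI)
      show "\<not> P n A'" if "A' \<inter> fst (fst x \<union> G, A \<inter> (fst x \<union> G)) = snd (fst x \<union> G, A \<inter> (fst x \<union> G))" for A'
        by (rule G(2)) (use that in auto)
    qed (use x A G in auto)
  qed
  have "\<exists>s. \<forall>n. (finite (fst (s n)) \<and> snd (s n) \<subseteq> fst (s n)) \<and>
      (fst (s n) \<subseteq> fst (s (Suc n)) \<and> snd (s (Suc n)) \<inter> fst (s n) = snd (s n) \<and>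
        (\<forall>A. A \<inter> fst (s (Suc n)) = snd (s (Suc n)) \<longrightarrow> \<not> P n A))"
    by (rule dependent_nat_choice, rule exI[of _ "({}, {})"], simp, rule step)
  then obtain s where "\<forall>n. (finite (fst (s n)) \<and> snd (s n) \<subseteq> fst (s n)) \<and>
      (fst (s n) \<subseteq> fst (s (Suc n)) \<and> snd (s (Suc n)) \<inter> fst (s n) = snd (s n) \<and>
        (\<forall>A. A \<inter> fst (s (Suc n)) = snd (s (Suc n)) \<longrightarrow> \<not> P n A))" ..
  then have s: "\<And>n. snd (s n) \<subseteq> fst (s n)" "\<And>n. fst (s n) \<subseteq> fst (s (Suc n))"
      "\<And>n. snd (s (Suc n)) \<inter> fst (s n) = snd (s n)"
      "\<And>n A. A \<inter> fst (s (Suc n)) = snd (s (Suc n)) \<Longrightarrow> \<not> P n A"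
    by simp_all
  have later: "fst (s n) \<subseteq> fst (s m) \<and> snd (s m) \<inter> fst (s n) = snd (s n)" if "n \<le> m" for n m
    using that
  proof (induction rule: dec_induct)
    case base then show ?case using s(1) by auto
  next
    case (step m) then show ?case using s(2)[of m] s(3)[of m] by blast
  qed
  define A where "A = (\<Union>n. snd (s n))"
  have "A \<inter> fst (s n) = snd (s n)" for n
  proof
    show "A \<inter> fst (s n) \<subseteq> snd (s n)"
    proof
      fix i assume "i \<in> A \<inter> fst (s n)"
      then obtain m where m: "i \<in> snd (s m)" "i \<in> fst (s n)" by (auto simp: A_def)
      then show "i \<in> snd (s n)"
        using later[of n m] later[of m n] by (cases "n \<le> m") auto
    qed
    show "snd (s n) \<subseteq> A \<inter> fst (s n)" using s(1) by (auto simp: A_def)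
  qed
  then have "\<not> P n A" for n by (rule s(4))
  then show False using ex[of A] by blast
qed

lemma roe_tail:
  fixes S :: "'b::metric_space ell2 \<Rightarrow>\<^sub>L 'b ell2"
  assumes "S \<in> uniform_roe_algebra" "0 < e"
  obtains n :: nat where "\<And>y. norm (ell2_cut (- cball y (real n)) (blinfun_apply S (ell2_basis y))) \<le> e"
proof -
  obtain c where c: "finite_propagation c" "dist c S < e"
    using assms unfolding uniform_roe_algebra_def closure_approachable by blast
  obtain r where r: "\<And>x y. dist x y > r \<Longrightarrow> ell2_inner (blinfun_apply c (ell2_basis x)) (ell2_basis y) = 0"
    using c(1) unfolding finite_propagation_def by blast
  obtain n :: nat where n: "r \<le> real n" using real_arch_simple by blast
  have "norm (ell2_cut (- cball y (real n)) (blinfun_apply S (ell2_basis y))) \<le> e" for y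
  proof -
    have "ell2_cut (- cball y (real n)) (blinfun_apply S (ell2_basis y))
        = ell2_cut (- cball y (real n)) (blinfun_apply (S - c) (ell2_basis y))"
      by (rule ell2_eqI)
         (use r[of y] n in \<open>auto simp: ell2_fun_cut blinfun.diff_left ell2_fun_diff ell2_inner_basis\<close>)
    also have "norm \<dots> \<le> norm (blinfun_apply (S - c) (ell2_basis y))"
      by (rule norm_ell2_cut_le)
    also have "\<dots> \<le> norm (S - c) * norm (ell2_basis y)" by (rule norm_blinfun)
    also have "\<dots> \<le> e" using c(2) by (simp add: dist_norm norm_minus_commute)
    finally show ?thesis .
  qed
  then show ?thesis by (rule that)
qed

text \<open>Each single operator \<open>u a v\<close> with \<open>a\<close> a band operator lies in a uniform Roe algebra, hence its
  columns are small far from the diagonal. The point is that one radius serves all sets \<open>A\<close>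
  simultaneously. For a fixed radius the condition is closed in \<open>A\<close>, because \<open>band_op r A \<xi>\<close> depends,
  up to a small error, only on the trace of \<open>A\<close> on a finite set; so \<open>uniform_on_cylinder\<close> gives one
  radius for all \<open>A\<close> in a cylinder. Since \<open>band_op\<close> is additive in \<open>A\<close>, an arbitrary set differs from
  one in the cylinder by subsets of a finite set, of which there are only finitely many.\<close>

lemma uniform_tails:
  fixes u :: "'a::metric_space ell2 \<Rightarrow> 'b::metric_space ell2"
  assumes uv: "roe_unitary u v" and ulf: "uniformly_locally_finite TYPE('a)"
    and r: "0 < r" and e: "0 < e"
  obtains R :: real where "0 < R"
    "\<And>A y. norm (ell2_cut (- cball y R) (u (blinfun_apply (band_op r A) (v (ell2_basis y))))) \<le> e"
proof -
  obtain N where N: "\<And>x :: 'a. finite (cball x r)" "\<And>x :: 'a. card (cball x r) \<le> N"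
    by (rule uniformly_locally_finiteE[OF ulf r]) blast
  define b where "b A y = u (blinfun_apply (band_op r A) (v (ell2_basis y)))" for A y
  define P where "P n A \<longleftrightarrow> (\<forall>y. norm (ell2_cut (- cball y (real n)) (b A y)) \<le> e / 3)" for n A
  have P_mono: "P m A" if "P n A" "n \<le> m" for n m A
    unfolding P_def
  proof
    fix y
    have "norm (ell2_cut (- cball y (real m)) (b A y)) \<le> norm (ell2_cut (- cball y (real n)) (b A y))"
      using that(2) by (intro ell2_cut_mono_norm) auto
    then show "norm (ell2_cut (- cball y (real m)) (b A y)) \<le> e / 3"
      using that(1) unfolding P_def by (meson order_trans)
  qed
  have P_ex: "\<exists>n. P n A" for A
  proof -
    obtain S where S: "S \<in> uniform_roe_algebra" "\<And>g. blinfun_apply S g = u (blinfun_apply (band_op r A) (v g))"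
      using uv band_op_in_roe[OF ulf r, of A] unfolding roe_unitary_def by blast
    show ?thesis
      by (rule roe_tail[OF S(1), of "e / 3"]) (use e in \<open>auto simp: P_def b_def S(2)\<close>)
  qed
  have P_closed: "P n A" if near: "\<And>F. finite F \<Longrightarrow> \<exists>A'. A' \<inter> F = A \<inter> F \<and> P n A'" for n A
    unfolding P_def
  proof
    fix y :: 'b
    let ?c = "ell2_cut (- cball y (real n))"
    show "norm (?c (b A y)) \<le> e / 3"
    proof (rule field_le_epsilon)
      fix t :: real assume t: "0 < t"
      define \<xi> where "\<xi> = v (ell2_basis y)"
      have t': "0 < t / (2 * real N + 1)" using t by simp
      obtain G where G: "finite G" "norm (\<xi> - ell2_cut G \<xi>) < t / (2 * real N + 1)"
        using ell2_finite_approximation[OF t'] .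
      \<comment> \<open>the matrix positions that can act on the finitely supported part of \<open>\<xi>\<close>\<close>
      define F where "F = (\<Union>x'\<in>G. (\<lambda>x. (x, x')) ` cball x' r)"
      have finF: "finite F" using G(1) N by (simp add: F_def)
      obtain A' where A': "A' \<inter> F = A \<inter> F" "P n A'" using near[OF finF] by blast
      let ?T = "\<lambda>A. blinfun_apply (band_op r A)"
      have "?T A (ell2_cut G \<xi>) = ?T A' (ell2_cut G \<xi>)"
      proof (rule ell2_eqI)
        fix x
        have "(x, x') \<in> A \<longleftrightarrow> (x, x') \<in> A'" if "x' \<in> G" "x' \<in> cball x r" for x'
        proof -
          have "x \<in> cball x' r" using that(2) by (simp add: dist_commute)
          then have "(x, x') \<in> F" using that(1) unfolding F_def by blast
          then show ?thesis using A'(1) by blast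
        qed
        then show "ell2_fun (?T A (ell2_cut G \<xi>)) x = ell2_fun (?T A' (ell2_cut G \<xi>)) x"
          by (auto simp: band_op_fun[OF N] band_fun_def ell2_fun_cut intro!: sum.cong)
      qed
      then have "?T A \<xi> - ?T A' \<xi> = ?T A (\<xi> - ell2_cut G \<xi>) - ?T A' (\<xi> - ell2_cut G \<xi>)"
        by (simp add: blinfun.diff_right)
      also have "norm \<dots> \<le> real N * norm (\<xi> - ell2_cut G \<xi>) + real N * norm (\<xi> - ell2_cut G \<xi>)"
        by (rule order_trans[OF norm_triangle_ineq4]) (intro add_mono band_op_norm[OF N])
      also have "\<dots> = 2 * real N * norm (\<xi> - ell2_cut G \<xi>)" by simp
      also have "\<dots> \<le> (2 * real N + 1) * norm (\<xi> - ell2_cut G \<xi>)" by (intro mult_right_mono) auto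
      also have "\<dots> \<le> (2 * real N + 1) * (t / (2 * real N + 1))"
        using G(2) by (intro mult_left_mono) auto
      also have "\<dots> = t"
        using t' by (simp add: add_nonneg_eq_0_iff)
      finally have "norm (b A y - b A' y) \<le> t"
        unfolding b_def \<xi>_def[symmetric]
        by (simp add: roe_unitary_diff[OF uv, symmetric] roe_unitary_norm[OF uv])
      then have "norm (?c (b A y) - ?c (b A' y)) \<le> t"
        unfolding ell2_cut_diff[symmetric] by (rule order_trans[OF norm_ell2_cut_le])
      moreover have "norm (?c (b A' y)) \<le> e / 3" using A'(2) by (simp add: P_def)
      ultimately show "norm (?c (b A y)) \<le> e / 3 + t"
        using norm_triangle_sub[of "?c (b A y)" "?c (b A' y)"] by linarith
    qed
  qed
  have "\<exists>n F B. finite F \<and> B \<subseteq> F \<and> (\<forall>A. A \<inter> F = B \<longrightarrow> P n A)"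
  proof (rule uniform_on_cylinder[of P])
    show "\<exists>n. P n A" for A by (rule P_ex)
    show "P n A" if "\<And>F. finite F \<Longrightarrow> \<exists>A'. A' \<inter> F = A \<inter> F \<and> P n A'" for n A
      using that by (rule P_closed)
  qed blast
  then obtain n F B where F: "finite F" "B \<subseteq> F" and nFB: "\<And>A. A \<inter> F = B \<Longrightarrow> P n A"
    by blast
  obtain k where k: "\<And>A. P (k A) A" using choice[of "\<lambda>A n. P n A"] P_ex by auto
  define m where "m = Max (insert n (k ` Pow F))"
  have Pm: "P m A" if "A \<subseteq> F \<or> A \<inter> F = B" for A
  proof -
    have fin: "finite (insert n (k ` Pow F))" using F(1) by simp
    from that show ?thesis
    proof
      assume "A \<subseteq> F"
      then have "k A \<le> m" unfolding m_def using fin by (intro Max_ge) auto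
      then show ?thesis using k P_mono by blast
    next
      assume "A \<inter> F = B"
      moreover have "n \<le> m" unfolding m_def using fin by (intro Max_ge) auto
      ultimately show ?thesis using nFB P_mono by blast
    qed
  qed
  have all: "norm (ell2_cut (- cball y (real m)) (b A y)) \<le> e" for A and y :: 'b
  proof -
    let ?c = "ell2_cut (- cball y (real m))"
    let ?C = "(A - F) \<union> B" and ?\<xi> = "v (ell2_basis y)"
    have "blinfun_apply (band_op r A) ?\<xi>
        = blinfun_apply (band_op r ?C) ?\<xi> - blinfun_apply (band_op r B) ?\<xi>
          + blinfun_apply (band_op r (A \<inter> F)) ?\<xi>"
    proof (rule ell2_eqI)
      fix x
      have "band_fun r A ?\<xi> x = band_fun r ?C ?\<xi> x - band_fun r B ?\<xi> x + band_fun r (A \<inter> F) ?\<xi> x"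
        unfolding band_fun_def sum_subtractf[symmetric] sum.distrib[symmetric]
        using F(2) by (intro sum.cong) auto
      then show "ell2_fun (blinfun_apply (band_op r A) ?\<xi>) x
          = ell2_fun (blinfun_apply (band_op r ?C) ?\<xi> - blinfun_apply (band_op r B) ?\<xi>
            + blinfun_apply (band_op r (A \<inter> F)) ?\<xi>) x"
        by (simp add: band_op_fun[OF N] ell2_fun_add ell2_fun_diff)
    qed
    then have split: "?c (b A y) = ?c (b ?C y) - ?c (b B y) + ?c (b (A \<inter> F) y)"
      by (simp add: b_def roe_unitary_add[OF uv] roe_unitary_diff[OF uv] ell2_cut_add ell2_cut_diff)
    have "norm (?c (b ?C y)) \<le> e / 3" "norm (?c (b B y)) \<le> e / 3"
        "norm (?c (b (A \<inter> F) y)) \<le> e / 3"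
      using Pm[of ?C] Pm[of B] Pm[of "A \<inter> F"] F(2) unfolding P_def by auto
    then show ?thesis
      unfolding split using norm_triangle_ineq[of "?c (b ?C y) - ?c (b B y)" "?c (b (A \<inter> F) y)"]
        norm_triangle_ineq4[of "?c (b ?C y)" "?c (b B y)"]
      by linarith
  qed
  show ?thesis
  proof (rule that[of "real m + 1"])
    fix A and y :: 'b
    have "norm (ell2_cut (- cball y (real m + 1)) (b A y)) \<le> norm (ell2_cut (- cball y (real m)) (b A y))"
      by (intro ell2_cut_mono_norm) auto
    also have "\<dots> \<le> e" by (rule all)
    finally show "norm (ell2_cut (- cball y (real m + 1))
        (u (blinfun_apply (band_op r A) (v (ell2_basis y))))) \<le> e"
      by (simp only: b_def)
  qed simp
qed

section \<open>From the unitary to the coarse equivalence\<close>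

text \<open>Choosing the signs one after another, each new vector can be given the sign that makes its
  inner product with the current signed sum nonpositive.\<close>

lemma balanced_signs:
  fixes w :: "'i \<Rightarrow> 'v::real_inner"
  assumes "finite F"
  shows "\<exists>C\<subseteq>F. (norm (sum w C - sum w (F - C)))\<^sup>2 \<le> (\<Sum>i\<in>F. (norm (w i))\<^sup>2)"
  using assms
proof (induction F)
  case empty then show ?case by simp
next
  case (insert i F)
  then obtain C where C: "C \<subseteq> F" "(norm (sum w C - sum w (F - C)))\<^sup>2 \<le> (\<Sum>i\<in>F. (norm (w i))\<^sup>2)"
    by blast
  define s where "s = sum w C - sum w (F - C)"
  have fin: "finite C" "i \<notin> C" "finite (F - C)" "i \<notin> F - C"
    using C(1) insert.hyps by (auto intro: finite_subset)
  have sq: "(norm (s + w i))\<^sup>2 = (norm s)\<^sup>2 + (norm (w i))\<^sup>2 + 2 * inner s (w i)"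
      "(norm (s - w i))\<^sup>2 = (norm s)\<^sup>2 + (norm (w i))\<^sup>2 - 2 * inner s (w i)"
    by (simp_all add: power2_norm_eq_inner inner_add_left inner_add_right inner_diff_left
        inner_diff_right inner_commute)
  show ?case
  proof (cases "inner s (w i) \<le> 0")
    case True
    have "insert i F - insert i C = F - C" using insert.hyps by auto
    then have "sum w (insert i C) - sum w (insert i F - insert i C) = s + w i"
      using fin by (simp add: s_def)
    then show ?thesis using C insert.hyps True sq(1)
      by (intro exI[of _ "insert i C"]) (auto simp: s_def[symmetric])
  next
    case False
    have "insert i F - C = insert i (F - C)" using fin by auto
    then have "sum w C - sum w (insert i F - C) = s - w i"
      using fin by (simp add: s_def)
    then show ?thesis using C insert.hyps False sq(2)
      by (intro exI[of _ C]) (auto simp: s_def[symmetric])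
  qed
qed

lemma linear_ell2_cut: "linear (ell2_cut S)"
  by (rule linearI; rule ell2_eqI) (simp_all add: ell2_fun_cut ell2_fun_add scaleR_ell2_eq ell2_fun_scale)

lemma linear_roe_unitary: "roe_unitary u v \<Longrightarrow> linear u"
  by (rule linearI) (simp_all add: roe_unitary_add scaleR_ell2_eq roe_unitary_scale)

text \<open>This is the heart of the matter: the unit vectors \<open>h = u \<delta>\<^sub>x\<close> cannot spread out uniformly thinly.
  If all entries of \<open>h\<close> had modulus at most \<open>d\<close>, consider the vectors \<open>w y\<close>, the restrictions to the
  ball \<open>B\<close> around \<open>x\<close> of \<open>h y\<close> times \<open>v \<delta>\<^sub>y\<close>. The sum of their squared norms is at most \<open>d\<^sup>2\<close> times the
  number of points of \<open>B\<close>, so balanced signs split the essential support \<open>F\<close> of \<open>h\<close> into \<open>C\<close> and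
  \<open>F - C\<close> such that the images under \<open>v\<close> of the two parts of \<open>h\<close> almost agree on \<open>B\<close>. By
  \<open>uniform_tails\<close>, applied to the coordinate projections, both images are small off \<open>B\<close>, hence they are
  close to each other. But the two parts of \<open>h\<close> are orthogonal, so their difference
  has the norm of \<open>h\<close> restricted to \<open>F\<close>, which is almost one.\<close>

lemma large_entries:
  fixes u :: "'a::metric_space ell2 \<Rightarrow> 'b::metric_space ell2"
  assumes uv: "roe_unitary u v"
    and ulfX: "uniformly_locally_finite TYPE('a)" and ulfY: "uniformly_locally_finite TYPE('b)"
  obtains d where "0 < d" "\<And>x. \<exists>y. d < cmod (ell2_fun (u (ell2_basis x)) y)"
proof -
  note vu = roe_unitary_sym[OF uv]
  obtain R where R: "0 < R" and tail0: "\<And>A x. norm (ell2_cut (- cball x R)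
      (v (blinfun_apply (band_op 1 A) (u (ell2_basis x))))) \<le> 1 / 8"
    by (rule uniform_tails[OF vu ulfY, of 1 "1 / 8"]) auto
  have tail: "norm (ell2_cut (- cball x R) (v (ell2_cut C (u (ell2_basis x))))) \<le> 1 / 8" for C x
    using tail0[of x "Id_on C"] by (simp add: band_op_diagonal[OF ulfY])
  obtain K where K: "\<And>x :: 'a. finite (cball x R)" "\<And>x :: 'a. card (cball x R) \<le> K"
    by (rule uniformly_locally_finiteE[OF ulfX R]) blast
  \<comment> \<open>small enough that \<open>d\<^sup>2 * K \<le> (1 / 4)\<^sup>2\<close>\<close>
  define d where "d = 1 / (4 * (real K + 1))"
  have d: "0 < d" by (simp add: d_def)
  have "d\<^sup>2 * real K \<le> d\<^sup>2 * (real K + 1)\<^sup>2"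
    by (intro mult_left_mono) (auto simp: power2_eq_square algebra_simps)
  also have "\<dots> = (d * (real K + 1))\<^sup>2" by (simp add: power_mult_distrib)
  also have "d * (real K + 1) = 1 / 4"
    by (simp add: d_def add_nonneg_eq_0_iff divide_simps)
  finally have dK: "d\<^sup>2 * real K \<le> (1 / 4)\<^sup>2" .
  have "\<exists>y. d < cmod (ell2_fun (u (ell2_basis x)) y)" for x
  proof (rule ccontr)
    assume "\<nexists>y. d < cmod (ell2_fun (u (ell2_basis x)) y)"
    then have small: "cmod (ell2_fun (u (ell2_basis x)) y) \<le> d" for y by (meson not_le)
    define h where "h = u (ell2_basis x)"
    have h1: "norm h = 1" by (simp add: h_def roe_unitary_norm[OF uv])
    obtain F where F: "finite F" "norm (h - ell2_cut F h) < 1 / 4"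
      using ell2_finite_approximation[of "1 / 4" h] by auto
    let ?B = "cball x R"
    define w where "w y = ell2_cut ?B (v (ell2_scale (ell2_fun h y) (ell2_basis y)))" for y
    obtain C where C: "C \<subseteq> F" "(norm (sum w C - sum w (F - C)))\<^sup>2 \<le> (\<Sum>y\<in>F. (norm (w y))\<^sup>2)"
      using balanced_signs[OF F(1), of w] by blast
    have "(norm (w y))\<^sup>2 \<le> d\<^sup>2 * (\<Sum>z\<in>?B. (cmod (ell2_fun (u (ell2_basis z)) y))\<^sup>2)" for y
    proof -
      have "(norm (w y))\<^sup>2
          = (cmod (ell2_fun h y))\<^sup>2 * (\<Sum>z\<in>?B. (cmod (ell2_fun (u (ell2_basis z)) y))\<^sup>2)"
        unfolding w_def norm_ell2_cut_finite[OF K(1)] sum_distrib_left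
        by (rule sum.cong)
           (simp_all add: roe_unitary_scale[OF vu] ell2_fun_scale norm_mult power_mult_distrib
             roe_unitary_entry[OF uv])
      also have "\<dots> \<le> d\<^sup>2 * (\<Sum>z\<in>?B. (cmod (ell2_fun (u (ell2_basis z)) y))\<^sup>2)"
        using small[of y] by (intro mult_right_mono power_mono sum_nonneg) (auto simp: h_def)
      finally show ?thesis .
    qed
    then have "(\<Sum>y\<in>F. (norm (w y))\<^sup>2)
        \<le> (\<Sum>y\<in>F. d\<^sup>2 * (\<Sum>z\<in>?B. (cmod (ell2_fun (u (ell2_basis z)) y))\<^sup>2))"
      by (rule sum_mono)
    also have "\<dots> = d\<^sup>2 * (\<Sum>z\<in>?B. \<Sum>y\<in>F. (cmod (ell2_fun (u (ell2_basis z)) y))\<^sup>2)"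
      unfolding sum_distrib_left[symmetric] by (subst sum.swap) simp
    also have "\<dots> \<le> d\<^sup>2 * (\<Sum>z\<in>?B. 1)"
    proof (intro mult_left_mono sum_mono)
      fix z
      have "norm (ell2_cut F (u (ell2_basis z))) \<le> 1"
        using norm_ell2_cut_le[of F "u (ell2_basis z)"] by (simp add: roe_unitary_norm[OF uv])
      then have "(norm (ell2_cut F (u (ell2_basis z))))\<^sup>2 \<le> 1" by (simp add: power_le_one)
      then show "(\<Sum>y\<in>F. (cmod (ell2_fun (u (ell2_basis z)) y))\<^sup>2) \<le> 1"
        by (simp only: norm_ell2_cut_finite[OF F(1)])
    qed simp
    also have "\<dots> \<le> d\<^sup>2 * real K" using K(2)[of x] by (intro mult_left_mono) auto
    also note dK
    finally have "(norm (sum w C - sum w (F - C)))\<^sup>2 \<le> (1 / 4)\<^sup>2" using C(2) by linarith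
    then have signs: "norm (sum w C - sum w (F - C)) \<le> 1 / 4" by (rule power2_le_imp_le) simp
    have sum_w: "sum w D = ell2_cut ?B (v (ell2_cut D h))" if "D \<subseteq> F" for D
    proof -
      have "finite D" using that F(1) by (rule finite_subset)
      then show ?thesis
        by (simp add: w_def ell2_cut_eq_sum[of D] linear_sum[OF linear_roe_unitary[OF vu]]
            linear_sum[OF linear_ell2_cut])
    qed
    have tail_h: "norm (ell2_cut (- ?B) (v (ell2_cut D h))) \<le> 1 / 8" for D
      unfolding h_def by (rule tail)
    let ?p = "v (ell2_cut C h)" and ?q = "v (ell2_cut (F - C) h)"
    have inside: "norm (ell2_cut ?B (?p - ?q)) \<le> 1 / 4"
      using signs C(1) by (simp add: sum_w ell2_cut_diff)
    have "norm (ell2_cut (- ?B) (?p - ?q)) \<le> 1 / 8 + 1 / 8"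
      unfolding ell2_cut_diff
      by (rule order_trans[OF norm_triangle_ineq4]) (intro add_mono tail_h)
    then have "norm (?p - ?q) \<le> 1 / 2"
      using inside norm_triangle_ineq[of "ell2_cut ?B (?p - ?q)" "ell2_cut (- ?B) (?p - ?q)"]
      by (simp add: ell2_cut_split[symmetric])
    moreover have "norm (?p - ?q) = norm (ell2_cut F h)"
    proof -
      have "norm (?p - ?q) = norm (ell2_cut C h - ell2_cut (F - C) h)"
        by (simp add: roe_unitary_diff[OF vu, symmetric] roe_unitary_norm[OF vu])
      also have "\<dots> = norm (ell2_cut F h)"
        unfolding norm_ell2_def using C(1)
        by (intro arg_cong[of _ _ sqrt] infsum_cong) (auto simp: ell2_fun_diff ell2_fun_cut)
      finally show ?thesis .
    qed
    ultimately show False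
      using F(2) h1 norm_triangle_sub[of h "ell2_cut F h"] by linarith
  qed
  with d show ?thesis by (rule that)
qed

text \<open>Conjugating the matrix unit at \<open>(x, x')\<close> by the unitary gives an operator whose entry at
  \<open>(y, y')\<close> is, up to complex conjugation of one factor, the product of the two large entries in question. By \<open>uniform_tails\<close> such an entry can
  only occur near the diagonal, uniformly over all matrix units of propagation at most \<open>r\<close>.\<close>

lemma large_entries_controlled:
  fixes u :: "'a::metric_space ell2 \<Rightarrow> 'b::metric_space ell2"
  assumes uv: "roe_unitary u v" and ulf: "uniformly_locally_finite TYPE('a)"
    and r: "0 < r" and d: "0 < d"
  obtains R where "\<And>x x' y y'. \<lbrakk>dist x x' \<le> r; d < cmod (ell2_fun (u (ell2_basis x)) y);
      d < cmod (ell2_fun (u (ell2_basis x')) y')\<rbrakk> \<Longrightarrow> dist y y' \<le> R"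
proof -
  have d2: "0 < d\<^sup>2" using d by simp
  obtain R where tail: "\<And>A y. norm (ell2_cut (- cball y R)
      (u (blinfun_apply (band_op r A) (v (ell2_basis y))))) \<le> d\<^sup>2"
    by (rule uniform_tails[OF uv ulf r d2]) blast
  have "dist y y' \<le> R" if *: "dist x x' \<le> r" "d < cmod (ell2_fun (u (ell2_basis x)) y)"
      "d < cmod (ell2_fun (u (ell2_basis x')) y')" for x x' y y'
  proof (rule ccontr)
    assume "\<not> dist y y' \<le> R"
    then have out: "y \<in> - cball y' R" by (simp add: dist_commute)
    let ?T = "u (blinfun_apply (band_op r {(x, x')}) (v (ell2_basis y')))"
    have "d\<^sup>2 < cmod (ell2_fun (u (ell2_basis x')) y') * cmod (ell2_fun (u (ell2_basis x)) y)"
      unfolding power2_eq_square using * d by (intro mult_strict_mono) auto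
    also have "\<dots> = cmod (ell2_fun ?T y)"
      using *(1) by (simp add: band_op_singleton[OF ulf r] roe_unitary_scale[OF uv] ell2_fun_scale
          norm_mult roe_unitary_entry[OF uv])
    also have "\<dots> = cmod (ell2_fun (ell2_cut (- cball y' R) ?T) y)"
      using out by (simp add: ell2_fun_cut)
    also have "\<dots> \<le> norm (ell2_cut (- cball y' R) ?T)" by (rule ell2_fun_le_norm)
    also have "\<dots> \<le> d\<^sup>2" by (rule tail)
    finally show False by simp
  qed
  then show ?thesis by (rule that)
qed

lemma coarse_mapI:
  assumes "\<And>r. 0 < r \<Longrightarrow> \<exists>R. \<forall>x x'. dist x x' \<le> r \<longrightarrow> dist (f x) (f x') \<le> R"
  shows "coarse_map f"
  unfolding coarse_map_def
proof (intro allI impI)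
  fix r :: real assume "0 < r"
  then obtain R where "\<forall>x x'. dist x x' \<le> r \<longrightarrow> dist (f x) (f x') \<le> R" using assms by blast
  then have "(SUP (x, y)\<in>{(x, y). dist x y \<le> r}. ereal (dist (f x) (f y))) \<le> ereal R"
    by (intro SUP_least) auto
  then show "(SUP (x, y)\<in>{(x, y). dist x y \<le> r}. ereal (dist (f x) (f y))) < \<infinity>"
    by (rule order_le_less_trans) simp
qed

text \<open>Sending each point to the position of a large entry defines the coarse equivalence. That the two
  compositions are close to the identity is again an instance of \<open>large_entries_controlled\<close>: the
  point \<open>f x\<close> carries a large entry for both \<open>x\<close> and \<open>g (f x)\<close>.\<close>

lemma roe_unitary_coarsely_equivalent:
  fixes u :: "'a::metric_space ell2 \<Rightarrow> 'b::metric_space ell2"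
  assumes uv: "roe_unitary u v"
    and ulfX: "uniformly_locally_finite TYPE('a)" and ulfY: "uniformly_locally_finite TYPE('b)"
  shows "coarsely_equivalent TYPE('a) TYPE('b)"
proof -
  note vu = roe_unitary_sym[OF uv]
  obtain d1 where d1: "0 < d1" "\<And>x. \<exists>y. d1 < cmod (ell2_fun (u (ell2_basis x)) y)"
    by (rule large_entries[OF uv ulfX ulfY]) blast
  obtain d2 where d2: "0 < d2" "\<And>y. \<exists>x. d2 < cmod (ell2_fun (v (ell2_basis y)) x)"
    by (rule large_entries[OF vu ulfY ulfX]) blast
  define d where "d = min d1 d2"
  have d: "0 < d" using d1(1) d2(1) by (simp add: d_def)
  have "\<exists>y. d < cmod (ell2_fun (u (ell2_basis x)) y)" for x
    using d1(2)[of x] unfolding d_def by (meson min.strict_coboundedI1)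
  then obtain f where f: "\<And>x. d < cmod (ell2_fun (u (ell2_basis x)) (f x))" by metis
  have "\<exists>x. d < cmod (ell2_fun (v (ell2_basis y)) x)" for y
    using d2(2)[of y] unfolding d_def by (meson min.strict_coboundedI2)
  then obtain g where g: "\<And>y. d < cmod (ell2_fun (v (ell2_basis y)) (g y))" by metis
  have gu: "d < cmod (ell2_fun (u (ell2_basis (g y))) y)" for y
    using g[of y] by (simp add: roe_unitary_entry[OF uv])
  have fv: "d < cmod (ell2_fun (v (ell2_basis (f x))) x)" for x
    using f[of x] by (simp add: roe_unitary_entry[OF uv])
  have "coarse_map f"
  proof (rule coarse_mapI)
    fix r :: real assume "0 < r"
    then obtain R where "\<And>x x' y y'. \<lbrakk>dist x x' \<le> r; d < cmod (ell2_fun (u (ell2_basis x)) y);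
        d < cmod (ell2_fun (u (ell2_basis x')) y')\<rbrakk> \<Longrightarrow> dist y y' \<le> R"
      using large_entries_controlled[OF uv ulfX _ d] by metis
    then show "\<exists>R. \<forall>x x'. dist x x' \<le> r \<longrightarrow> dist (f x) (f x') \<le> R" using f by blast
  qed
  moreover have "coarse_map g"
  proof (rule coarse_mapI)
    fix r :: real assume "0 < r"
    then obtain R where "\<And>x x' y y'. \<lbrakk>dist x x' \<le> r; d < cmod (ell2_fun (v (ell2_basis x)) y);
        d < cmod (ell2_fun (v (ell2_basis x')) y')\<rbrakk> \<Longrightarrow> dist y y' \<le> R"
      using large_entries_controlled[OF vu ulfY _ d] by metis
    then show "\<exists>R. \<forall>x x'. dist x x' \<le> r \<longrightarrow> dist (g x) (g x') \<le> R" using g by blast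
  qed
  moreover have "(SUP x. ereal (dist (g (f x)) x)) < \<infinity>"
  proof -
    obtain R where R: "\<And>x x' y y'. \<lbrakk>dist x x' \<le> 1; d < cmod (ell2_fun (v (ell2_basis x)) y);
        d < cmod (ell2_fun (v (ell2_basis x')) y')\<rbrakk> \<Longrightarrow> dist y y' \<le> R"
      by (rule large_entries_controlled[OF vu ulfY zero_less_one d]) blast
    have "dist (g (f x)) x \<le> R" for x by (rule R[OF _ g fv]) simp
    then have "(SUP x. ereal (dist (g (f x)) x)) \<le> ereal R" by (intro SUP_least) simp
    then show ?thesis by (rule order_le_less_trans) simp
  qed
  moreover have "(SUP y. ereal (dist (f (g y)) y)) < \<infinity>"
  proof -
    obtain R where R: "\<And>x x' y y'. \<lbrakk>dist x x' \<le> 1; d < cmod (ell2_fun (u (ell2_basis x)) y);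
        d < cmod (ell2_fun (u (ell2_basis x')) y')\<rbrakk> \<Longrightarrow> dist y y' \<le> R"
      by (rule large_entries_controlled[OF uv ulfX zero_less_one d]) blast
    have "dist (f (g y)) y \<le> R" for y by (rule R[OF _ f gu]) simp
    then have "(SUP y. ereal (dist (f (g y)) y)) \<le> ereal R" by (intro SUP_least) simp
    then show ?thesis by (rule order_le_less_trans) simp
  qed
  ultimately show ?thesis unfolding coarsely_equivalent_def by blast
qed

theorem corollary1p5:
  fixes e :: "'b::metric_space \<Rightarrow> 'h::{real_inner, complete_space}"
  assumes "uniformly_locally_finite TYPE('a::metric_space)"
    and "uniformly_locally_finite TYPE('b)"
    and "coarse_embedding e"
    and "star_isomorphic (uniform_roe_algebra :: ('a ell2 \<Rightarrow>\<^sub>L 'a ell2) set)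
                         (uniform_roe_algebra :: ('b ell2 \<Rightarrow>\<^sub>L 'b ell2) set)"
  shows "coarsely_equivalent TYPE('a) TYPE('b)"
proof -
  obtain \<Phi> where "star_isomorphism (uniform_roe_algebra :: ('a ell2 \<Rightarrow>\<^sub>L 'a ell2) set)
      (uniform_roe_algebra :: ('b ell2 \<Rightarrow>\<^sub>L 'b ell2) set) \<Phi>"
    using assms(4) unfolding star_isomorphic_def by blast
  then obtain u :: "'a ell2 \<Rightarrow> 'b ell2" and v where "roe_unitary u v"
    by (rule star_isomorphism_spatial)
  then show ?thesis using assms(1,2) by (rule roe_unitary_coarsely_equivalent)
qed

end
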